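(* Assume that the finite game $\Gamma=(N,(C_i)_{i\in N},(U_i)_{i\in N})$ has a unique correlated equilibrium $\sigma$ (which is then a Nash equilibrium, hence may be seen as a mixed strategy profile). In any full dual reduction of $\Gamma$, and in any elementary iterative dual reduction of $\Gamma$, the set of pure strategy profiles is reduced to $\{\sigma\}$. In particular, $\Gamma$ has a unique full dual reduction.
   Context: A finite game in strategic form is $\Gamma=(N,(C_i)_{i\in N},(U_i)_{i\in N})$, where $N$ is a finite nonempty set of players, $C_i$ is the finite nonempty set of pure strategies of player $i$, $C=\prod_{j\in N}C_j$, $C_{-i}=\prod_{j\ne i}C_j$, and $U_i:C\to\mathbb{R}$ is the utility function of player $i$, extended multilinearly to mixed strategies. A correlated equilibrium is $\mu\in\Delta(C)$ with $\sum_{c_{-i}\in C_{-i}}\mu(c)[U_i(c_{-i},d_i)-U_i(c)]\le 0$ for all $i\in N$, $c_i,d_i\in C_i$ (where $c=(c_{-i},c_i)$). It is strict if this inequality is strict for all $i$, all $c_i$ with positive marginal probability in $\mu$ and all $d_i\ne c_i$. A game is elementary if it has a strict correlated equilibrium with full support (i.e. $\mu(c)>0$ for all $c\in C$). A deviation plan for player $i$ is a map $\alpha_i:C_i\to\Delta(C_i)$; write $\alpha_i\ast c_i$ for the image of $c_i$, $\alpha_i(d_i|c_i)=(\alpha_i\ast c_i)(d_i)$, and $\alpha_i\ast\sigma_i=\sum_{c_i}\sigma_i(c_i)(\alpha_i\ast c_i)$ for $\sigma_i\in\Delta(C_i)$. A dual vector of $\Gamma$ is a profile of deviation plans $\alpha=(\alpha_i)_{i\in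 N}$ such that $\sum_{i\in N}[U_i(c_{-i},\alpha_i\ast c_i)-U_i(c)]\ge 0$ for every $c\in C$. It is full if $\alpha_i(d_i|c_i)>0$ whenever $\beta_i(d_i|c_i)>0$ for some dual vector $\beta$. A nonempty $B_i\subset C_i$ is $\alpha_i$-absorbing if $\alpha_i\ast c_i$ has support in $B_i$ for every $c_i\in B_i$, and minimal $\alpha_i$-absorbing if moreover it has no nonempty proper absorbing subset. For each minimal $\alpha_i$-absorbing set there is a unique $\alpha_i$-stationary mixed strategy ($\alpha_i\ast\sigma_i=\sigma_i$) supported in it; $C_i/\alpha_i\subset\Delta(C_i)$ is the set of these strategies, and $\Gamma/\alpha$ is the game with player set $N$, pure strategy sets $C_i/\alpha_i$ and the same utility functions. A (full) dual reduction of $\Gamma$ is a game $\Gamma/\alpha$ with $\alpha$ a (full) dual vector. An iterative dual reduction of $\Gamma$ is a game $\Gamma/\alpha^1/\alpha^2/\cdots/\alpha^K$ where each $\alpha^k$ is a dual vector of $\Gamma/\alpha^1/\cdots/\alpha^{k-1}$; its pure strategies are identified, by composing mixtures, with mixed strategies of $\Gamma$. *)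

theory Defs
  imports "HOL-Probability.Probability"
begin

text \<open>
  Pure strategies of all players live in one type; \<^const>\<open>PiE\<close> keeps the
  strategy profiles extensional, so that they are determined by their values on the players.
\<close>

record ('i, 's) game =
  players :: "'i set"
  strategies :: "'i \<Rightarrow> 's set"
  utility :: "'i \<Rightarrow> ('i \<Rightarrow> 's) \<Rightarrow> real"

definition finite_game :: "('i, 's) game \<Rightarrow> bool" where
  "finite_game \<Gamma> \<longleftrightarrow> finite (players \<Gamma>) \<and> players \<Gamma> \<noteq> {} \<and>
     (\<forall>i\<in>players \<Gamma>. finite (strategies \<Gamma> i) \<and> strategies \<Gamma> i \<noteq> {})"

definition profiles :: "('i, 's) game \<Rightarrow> ('i \<Rightarrow> 's) set" where
  "profiles \<Gamma> = PiE (players \<Gamma>) (strategies \<Gamma>)"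

definition profiles_without :: "('i, 's) game \<Rightarrow> 'i \<Rightarrow> ('i \<Rightarrow> 's) set" where
  "profiles_without \<Gamma> i = PiE (players \<Gamma> - {i}) (strategies \<Gamma>)"

definition mixed_strategies :: "('i, 's) game \<Rightarrow> 'i \<Rightarrow> 's pmf set" where
  "mixed_strategies \<Gamma> i = {s. set_pmf s \<subseteq> strategies \<Gamma> i}"

definition mixed_profiles :: "('i, 's) game \<Rightarrow> ('i \<Rightarrow> 's pmf) set" where
  "mixed_profiles \<Gamma> = PiE (players \<Gamma>) (mixed_strategies \<Gamma>)"

text \<open>
  The default value of \<^const>\<open>Pi_pmf\<close> is \<^const>\<open>undefined\<close>, so that
  the product distribution is carried by extensional profiles.
\<close>

definition product_distribution :: "('i, 's) game \<Rightarrow> ('i \<Rightarrow> 's pmf) \<Rightarrow> ('i \<Rightarrow> 's) pmf" where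
  "product_distribution \<Gamma> \<sigma> = Pi_pmf (players \<Gamma>) undefined \<sigma>"

definition mixed_utility :: "('i, 's) game \<Rightarrow> 'i \<Rightarrow> ('i \<Rightarrow> 's pmf) \<Rightarrow> real" where
  "mixed_utility \<Gamma> i \<sigma> = measure_pmf.expectation (product_distribution \<Gamma> \<sigma>) (utility \<Gamma> i)"

definition nash_equilibrium :: "('i, 's) game \<Rightarrow> ('i \<Rightarrow> 's pmf) \<Rightarrow> bool" where
  "nash_equilibrium \<Gamma> \<sigma> \<longleftrightarrow> \<sigma> \<in> mixed_profiles \<Gamma> \<and>
     (\<forall>i\<in>players \<Gamma>. \<forall>\<tau>\<in>mixed_strategies \<Gamma> i.
        mixed_utility \<Gamma> i (\<sigma>(i := \<tau>)) \<le> mixed_utility \<Gamma> i \<sigma>)"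

definition deviation_gain ::
  "('i, 's) game \<Rightarrow> ('i \<Rightarrow> 's) pmf \<Rightarrow> 'i \<Rightarrow> 's \<Rightarrow> 's \<Rightarrow> real" where
  "deviation_gain \<Gamma> \<mu> i ci di =
     (\<Sum>c\<in>profiles_without \<Gamma> i.
        pmf \<mu> (c(i := ci)) * (utility \<Gamma> i (c(i := di)) - utility \<Gamma> i (c(i := ci))))"

definition correlated_equilibrium :: "('i, 's) game \<Rightarrow> ('i \<Rightarrow> 's) pmf \<Rightarrow> bool" where
  "correlated_equilibrium \<Gamma> \<mu> \<longleftrightarrow> set_pmf \<mu> \<subseteq> profiles \<Gamma> \<and>
     (\<forall>i\<in>players \<Gamma>. \<forall>ci\<in>strategies \<Gamma> i. \<forall>di\<in>strategies \<Gamma> i.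
        deviation_gain \<Gamma> \<mu> i ci di \<le> 0)"

definition strict_correlated_equilibrium :: "('i, 's) game \<Rightarrow> ('i \<Rightarrow> 's) pmf \<Rightarrow> bool" where
  "strict_correlated_equilibrium \<Gamma> \<mu> \<longleftrightarrow> correlated_equilibrium \<Gamma> \<mu> \<and>
     (\<forall>i\<in>players \<Gamma>. \<forall>ci\<in>strategies \<Gamma> i. \<forall>di\<in>strategies \<Gamma> i.
        pmf (map_pmf (\<lambda>c. c i) \<mu>) ci > 0 \<and> di \<noteq> ci \<longrightarrow> deviation_gain \<Gamma> \<mu> i ci di < 0)"

definition elementary :: "('i, 's) game \<Rightarrow> bool" where
  "elementary \<Gamma> \<longleftrightarrow>
     (\<exists>\<mu>. strict_correlated_equilibrium \<Gamma> \<mu> \<and> (\<forall>c\<in>profiles \<Gamma>. pmf \<mu> c > 0))"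

text \<open>
  A deviation plan \<open>a :: 's \<Rightarrow> 's pmf\<close> acts on a mixed strategy \<open>s\<close> by
  \<open>bind_pmf s a\<close>.
\<close>

definition deviation_plan :: "('i, 's) game \<Rightarrow> 'i \<Rightarrow> ('s \<Rightarrow> 's pmf) \<Rightarrow> bool" where
  "deviation_plan \<Gamma> i a \<longleftrightarrow> (\<forall>c\<in>strategies \<Gamma> i. a c \<in> mixed_strategies \<Gamma> i)"

definition dual_vector :: "('i, 's) game \<Rightarrow> ('i \<Rightarrow> 's \<Rightarrow> 's pmf) \<Rightarrow> bool" where
  "dual_vector \<Gamma> \<alpha> \<longleftrightarrow> (\<forall>i\<in>players \<Gamma>. deviation_plan \<Gamma> i (\<alpha> i)) \<and>
     (\<forall>c\<in>profiles \<Gamma>.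
        (\<Sum>i\<in>players \<Gamma>.
           mixed_utility \<Gamma> i ((\<lambda>j. return_pmf (c j))(i := \<alpha> i (c i))) - utility \<Gamma> i c) \<ge> 0)"

definition full_dual_vector :: "('i, 's) game \<Rightarrow> ('i \<Rightarrow> 's \<Rightarrow> 's pmf) \<Rightarrow> bool" where
  "full_dual_vector \<Gamma> \<alpha> \<longleftrightarrow> dual_vector \<Gamma> \<alpha> \<and>
     (\<forall>i\<in>players \<Gamma>. \<forall>ci\<in>strategies \<Gamma> i. \<forall>di\<in>strategies \<Gamma> i.
        (\<exists>\<beta>. dual_vector \<Gamma> \<beta> \<and> pmf (\<beta> i ci) di > 0) \<longrightarrow> pmf (\<alpha> i ci) di > 0)"

definition absorbing :: "'s set \<Rightarrow> ('s \<Rightarrow> 's pmf) \<Rightarrow> 's set \<Rightarrow> bool" where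
  "absorbing S a B \<longleftrightarrow> B \<noteq> {} \<and> B \<subseteq> S \<and> (\<forall>c\<in>B. set_pmf (a c) \<subseteq> B)"

definition minimal_absorbing :: "'s set \<Rightarrow> ('s \<Rightarrow> 's pmf) \<Rightarrow> 's set \<Rightarrow> bool" where
  "minimal_absorbing S a B \<longleftrightarrow> absorbing S a B \<and> (\<forall>B'. B' \<subset> B \<longrightarrow> \<not> absorbing S a B')"

definition stationary :: "('s \<Rightarrow> 's pmf) \<Rightarrow> 's pmf \<Rightarrow> bool" where
  "stationary a s \<longleftrightarrow> bind_pmf s a = s"

definition reduced_strategies :: "'s set \<Rightarrow> ('s \<Rightarrow> 's pmf) \<Rightarrow> 's pmf set" where
  "reduced_strategies S a =
     {s. \<exists>B. minimal_absorbing S a B \<and> stationary a s \<and> set_pmf s \<subseteq> B}"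

text \<open>
  The strategy sets are made extensional in the player, so that equality of reduced games
  does not see the values of a dual vector outside the player set.
\<close>

definition reduced_game ::
  "('i, 's) game \<Rightarrow> ('i \<Rightarrow> 's \<Rightarrow> 's pmf) \<Rightarrow> ('i, 's pmf) game" where
  "reduced_game \<Gamma> \<alpha> =
     \<lparr>players = players \<Gamma>,
      strategies = (\<lambda>i\<in>players \<Gamma>. reduced_strategies (strategies \<Gamma> i) (\<alpha> i)),
      utility = mixed_utility \<Gamma>\<rparr>"

definition full_dual_reduction :: "('i, 's) game \<Rightarrow> ('i, 's pmf) game \<Rightarrow> bool" where
  "full_dual_reduction \<Gamma> G \<longleftrightarrow> (\<exists>\<alpha>. full_dual_vector \<Gamma> \<alpha> \<and> G = reduced_game \<Gamma> \<alpha>)"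

text \<open>
  Reducing a game whose pure strategies are mixed strategies of \<open>\<Gamma>\<close> gives a game
  whose pure strategies are mixtures of mixed strategies of \<open>\<Gamma>\<close>.  Composing the
  mixtures turns it back into a game on mixed strategies of \<open>\<Gamma>\<close>, with the utility
  functions of \<open>\<Gamma>\<close>; by lemma \<open>mixed_utility_join\<close> below, this
  does not change payoffs.  No strategies are merged: distinct pure strategies of a reduced game
  have disjoint supports, since distinct minimal absorbing sets are disjoint.
\<close>

definition compose_mixtures ::
  "('i, 's) game \<Rightarrow> ('i, 's pmf pmf) game \<Rightarrow> ('i, 's pmf) game" where
  "compose_mixtures \<Gamma> H =
     \<lparr>players = players H,
      strategies = (\<lambda>i\<in>players H. join_pmf ` strategies H i),
      utility = mixed_utility \<Gamma>\<rparr>"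

text \<open>
  Zero reduction steps need no separate clause: the identity plan \<open>\<lambda>i. return_pmf\<close>
  is a dual vector, and its reduction is \<open>\<Gamma>\<close> with pure strategies viewed as point
  masses.
\<close>

inductive iterative_dual_reduction ::
  "('i, 's) game \<Rightarrow> ('i, 's pmf) game \<Rightarrow> bool" for \<Gamma> where
  single: "dual_vector \<Gamma> \<alpha> \<Longrightarrow> iterative_dual_reduction \<Gamma> (reduced_game \<Gamma> \<alpha>)"
| step: "iterative_dual_reduction \<Gamma> G \<Longrightarrow> dual_vector G \<alpha> \<Longrightarrow>
    iterative_dual_reduction \<Gamma> (compose_mixtures \<Gamma> (reduced_game G \<alpha>))"

lemma iterative_dual_reduction_players:
  "iterative_dual_reduction \<Gamma> G \<Longrightarrow> players G = players \<Gamma>"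
  by (induction rule: iterative_dual_reduction.induct)
     (simp_all add: reduced_game_def compose_mixtures_def)

lemma iterative_dual_reduction_utility:
  "iterative_dual_reduction \<Gamma> G \<Longrightarrow> utility G = mixed_utility \<Gamma>"
  by (induction rule: iterative_dual_reduction.induct)
     (simp_all add: reduced_game_def compose_mixtures_def)

lemma mixed_utility_join:
  fixes \<Gamma> :: "('i, 's) game"
  assumes G: "iterative_dual_reduction \<Gamma> G" and N: "finite (players \<Gamma>)"
    and fin: "\<And>j. j \<in> players \<Gamma> \<Longrightarrow> finite (set_pmf (\<tau> j))"
      "\<And>j s. j \<in> players \<Gamma> \<Longrightarrow> s \<in> set_pmf (\<tau> j) \<Longrightarrow> finite (set_pmf s)"
  shows "mixed_utility \<Gamma> i (\<lambda>j. join_pmf (\<tau> j)) = mixed_utility G i \<tau>"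
proof -
  let ?P = "Pi_pmf (players \<Gamma>) undefined \<tau>"
  let ?Q = "\<lambda>c :: 'i \<Rightarrow> 's pmf. Pi_pmf (players \<Gamma>) undefined c"
  have finP: "finite (set_pmf ?P)"
    using N fin(1) by (auto simp: set_Pi_pmf intro!: finite_PiE_dflt)
  have finQ: "finite (set_pmf (?Q c))" if "c \<in> set_pmf ?P" for c
  proof -
    have "c j \<in> set_pmf (\<tau> j)" if "j \<in> players \<Gamma>" for j
      using that \<open>c \<in> set_pmf ?P\<close> N by (auto simp: set_Pi_pmf PiE_dflt_def)
    then show ?thesis
      using N fin(2) by (auto simp: set_Pi_pmf intro!: finite_PiE_dflt)
  qed
  have "Pi_pmf (players \<Gamma>) undefined (\<lambda>j. join_pmf (\<tau> j)) = bind_pmf ?P ?Q"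
    using Pi_pmf_bind[OF N, of undefined \<tau> "\<lambda>_. id" undefined]
    by (simp add: join_eq_bind_pmf)
  then have "mixed_utility \<Gamma> i (\<lambda>j. join_pmf (\<tau> j))
      = (\<Sum>c\<in>set_pmf ?P. pmf ?P c * measure_pmf.expectation (?Q c) (utility \<Gamma> i))"
    unfolding mixed_utility_def product_distribution_def
    using pmf_expectation_bind[of "set_pmf ?P" ?Q ?P "utility \<Gamma> i"] finP finQ by simp
  also have "\<dots> = measure_pmf.expectation ?P (mixed_utility \<Gamma> i)"
    by (subst integral_measure_pmf[OF finP])
       (auto simp: mixed_utility_def product_distribution_def)
  also have "\<dots> = mixed_utility G i \<tau>"
    by (simp add: mixed_utility_def[of G] product_distribution_def
        iterative_dual_reduction_players[OF G] iterative_dual_reduction_utility[OF G])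
  finally show ?thesis .
qed

end

theory Submission
  imports Defs
begin

text \<open>
  The linear inequalities that define correlated equilibria and those that define dual vectors are
  dual to each other.  By Farkas' lemma this duality is complementary
  (lemma \<open>switch_complementarity\<close>): for a player \<open>i\<close> and strategies \<open>x\<close>, \<open>y\<close>, either
  the incentive constraint against switching from \<open>x\<close> to \<open>y\<close> is slack in some correlated
  equilibrium, or some dual vector moves \<open>x\<close> to \<open>y\<close> with positive probability.

  Every correlated equilibrium \<open>\<nu>\<close> of a reduced game induces one of \<open>\<Gamma>\<close>: draw a
  profile of mixed strategies from \<open>\<nu>\<close>, then let the players randomize independently
  (lemma \<open>reduced_equilibrium_induces_equilibrium\<close>).  Indeed, against opponents who play
  stationary strategies, the payoff of player \<open>i\<close> is subharmonic for the Markov chain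
  \<open>\<alpha> i\<close>, so its maximum is attained on a whole minimal absorbing set, hence by a pure
  strategy of the reduced game.  The equilibrium condition of the reduced game then makes the
  recommended mixed strategy attain this maximum at every pure strategy in its support.  The statement
  passes to iterated reductions (lemma \<open>iterated_equilibrium_induces_equilibrium\<close>).

  Now let \<open>\<mu>\<close> be the unique correlated equilibrium of \<open>\<Gamma>\<close>.  In an elementary
  iterated reduction \<open>G\<close>, a strict equilibrium with full support can be moved a little towards any
  profile \<open>c\<close> and remains an equilibrium.  Both equilibria induce \<open>\<mu>\<close>, and the induced
  distribution is linear in the equilibrium, so the product distribution of \<open>c\<close> is itself \<open>\<mu>\<close>
  (lemma \<open>elementary_iterate_profile\<close>); thus \<open>G\<close> has one profile only.
  Elementary iterated reductions exist, because a game that is not elementary has, by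
  complementarity, a dual vector that moves some strategy to another one, and reducing by it
  lowers the number of pure strategies.  So \<open>\<mu>\<close> is the product distribution of some
  \<open>\<sigma>\<close>, which is a Nash equilibrium.

  In the equilibrium \<open>\<mu>\<close> no incentive constraint is slack if \<open>x\<close> is outside the support of
  \<open>\<sigma> i\<close>, or if \<open>x\<close> and \<open>y\<close> are both in it.  By uniqueness and complementarity a
  full dual vector is positive at all these pairs (lemma \<open>full_dual_vector_positive\<close>).
  Hence every absorbing set of a full dual vector contains the support of \<open>\<sigma> i\<close>, so only
  one absorbing set is minimal, and the reduced game has a single profile, which must be
  \<open>\<sigma>\<close>.
\<close>

section \<open>Theorems of the alternative\<close>

text \<open>
  Tucker's key lemma.  The induction adds one vector \<open>a i\<close> at a time.  If the old \<open>u\<close> has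
  a negative product with it, all other vectors are shifted along \<open>a i\<close> into the hyperplane
  orthogonal to \<open>u\<close>; a solution for the shifted vectors then yields one for the original
  vectors, since \<open>u\<close> may be added to the new dual solution with any sign.
\<close>

lemma tucker_alternative:
  fixes a :: "'j \<Rightarrow> 'k \<Rightarrow> real"
  assumes "finite J" and "j0 \<in> J" and K: "finite K"
  shows "\<exists>x u. (\<forall>j\<in>J. x j \<ge> 0) \<and> (\<forall>k\<in>K. (\<Sum>j\<in>J. x j * a j k) = 0) \<and>
     (\<forall>j\<in>J. (\<Sum>k\<in>K. a j k * u k) \<ge> 0) \<and> x j0 + (\<Sum>k\<in>K. a j0 k * u k) > 0"
proof -
  let ?dot = "\<lambda>f u. \<Sum>k\<in>K. f k * u k"
  have "\<exists>x u. (\<forall>j\<in>insert j0 I. x j \<ge> 0) \<and> (\<forall>k\<in>K. (\<Sum>j\<in>insert j0 I. x j * a j k) = 0) \<and>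
     (\<forall>j\<in>insert j0 I. ?dot (a j) u \<ge> 0) \<and> x j0 + ?dot (a j0) u > 0"
    if "finite I" and "j0 \<notin> I" for I and a :: "'j \<Rightarrow> 'k \<Rightarrow> real"
    using that
  proof (induction I arbitrary: a rule: finite_induct)
    case empty
    show ?case
    proof (cases "?dot (a j0) (a j0) > 0")
      case True
      then show ?thesis
        by (intro exI[of _ "\<lambda>_. 0"] exI[of _ "a j0"]) auto
    next
      case False
      then have "a j0 k = 0" if "k \<in> K" for k
        using sum_nonneg[of K "\<lambda>k. a j0 k * a j0 k"]
          sum_nonneg_eq_0_iff[of K "\<lambda>k. a j0 k * a j0 k"] that K by auto
      then show ?thesis
        by (intro exI[of _ "\<lambda>_. 1"] exI[of _ "\<lambda>_. 0"]) auto
    qed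
  next
    case (insert i I)
    then have i: "i \<noteq> j0" "i \<notin> insert j0 I" and fin: "finite (insert j0 I)"
      and j0: "j0 \<notin> I" by auto
    obtain x u where x: "\<forall>j\<in>insert j0 I. x j \<ge> 0"
        "\<forall>k\<in>K. (\<Sum>j\<in>insert j0 I. x j * a j k) = 0"
      and u: "\<forall>j\<in>insert j0 I. ?dot (a j) u \<ge> 0" "x j0 + ?dot (a j0) u > 0"
      using insert.IH[OF j0, of a] by blast
    have swap: "insert j0 (insert i I) = insert i (insert j0 I)" by auto
    show ?case
    proof (cases "?dot (a i) u \<ge> 0")
      case True
      have "(\<Sum>j\<in>insert j0 I. (x(i := 0)) j * a j k) = (\<Sum>j\<in>insert j0 I. x j * a j k)" for k
        using i by (intro sum.cong) auto
      then show ?thesis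
        unfolding swap using True x u i fin
        by (intro exI[of _ "x(i := 0)"] exI[of _ u]) auto
    next
      case False
      \<comment> \<open>The shift coefficients that make \<open>b j\<close> orthogonal to \<open>u\<close>; they are
        nonnegative because \<open>u\<close> separates \<open>a i\<close> from the others.\<close>
      define l where "l j = - ?dot (a j) u / ?dot (a i) u" for j
      define b where "b j k = a j k + l j * a i k" for j k
      have l: "l j \<ge> 0" if "j \<in> insert j0 I" for j
        unfolding l_def using False u(1) that by (intro divide_nonpos_neg) auto
      have dot_b: "?dot (b j) v = ?dot (a j) v + l j * ?dot (a i) v" for j v
        by (simp add: b_def algebra_simps sum.distrib sum_distrib_left)
      have b_orth: "?dot (b j) u = 0" for j
        using False by (simp add: dot_b l_def)
      obtain y v where y: "\<forall>j\<in>insert j0 I. y j \<ge> 0"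
          "\<forall>k\<in>K. (\<Sum>j\<in>insert j0 I. y j * b j k) = 0"
        and v: "\<forall>j\<in>insert j0 I. ?dot (b j) v \<ge> 0" "y j0 + ?dot (b j0) v > 0"
        using insert.IH[OF j0, of b] by blast
      \<comment> \<open>The multiple of \<open>u\<close> that makes the new dual solution orthogonal to \<open>a i\<close>.\<close>
      define m where "m = - ?dot (a i) v / ?dot (a i) u"
      define v' where "v' k = v k + m * u k" for k
      have dot_v': "?dot f v' = ?dot f v + m * ?dot f u" for f
        by (simp add: v'_def algebra_simps sum.distrib sum_distrib_left)
      have ai: "?dot (a i) v' = 0"
        using False by (simp add: dot_v' m_def)
      have aj: "?dot (a j) v' = ?dot (b j) v" for j
        using dot_b[of j v'] ai dot_v'[of "b j"] b_orth by simp
      define y' where "y' = y(i := \<Sum>j\<in>insert j0 I. y j * l j)"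
      have "(\<Sum>j\<in>insert j0 I. y' j * a j k) = (\<Sum>j\<in>insert j0 I. y j * a j k)" for k
        unfolding y'_def using i by (intro sum.cong) auto
      moreover have "(\<Sum>j\<in>insert j0 I. y j * b j k) =
          (\<Sum>j\<in>insert j0 I. y j * a j k) + y' i * a i k" for k
        unfolding y'_def b_def
        by (simp only: fun_upd_same ring_distribs sum.distrib sum_distrib_right mult.assoc)
      ultimately have "(\<Sum>j\<in>insert i (insert j0 I). y' j * a j k) =
          (\<Sum>j\<in>insert j0 I. y j * b j k)" for k
        using sum.insert[OF fin i(2), of "\<lambda>j. y' j * a j k"] by (metis add.commute)
      moreover have "y' j \<ge> 0" if "j \<in> insert i (insert j0 I)" for j
        using that y(1) l by (auto simp: y'_def intro!: sum_nonneg mult_nonneg_nonneg simp del: sum.insert)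
      moreover have "y' j0 = y j0" using i by (simp add: y'_def)
      ultimately show ?thesis
        unfolding swap using y v ai aj
        by (intro exI[of _ y'] exI[of _ v']) auto
    qed
  qed
  from this[of "J - {j0}" a] show ?thesis
    using assms by (simp add: insert_absorb)
qed

text \<open>
  The sign constraint on \<open>v\<close> is put into Tucker's lemma by adjoining the unit vectors to the
  columns of \<open>-A\<close>; their coefficients become the slack in \<open>A w \<ge> 0\<close>.
\<close>

lemma farkas_alternative:
  fixes A :: "'x \<Rightarrow> 'y \<Rightarrow> real"
  assumes "finite X" "finite Y" "y0 \<in> Y"
  shows "(\<exists>v. (\<forall>x\<in>X. v x \<ge> 0) \<and> (\<forall>y\<in>Y. (\<Sum>x\<in>X. v x * A x y) \<le> 0) \<and> (\<Sum>x\<in>X. v x * A x y0) < 0) \<or>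
    (\<exists>w. (\<forall>y\<in>Y. w y \<ge> 0) \<and> w y0 > 0 \<and> (\<forall>x\<in>X. (\<Sum>y\<in>Y. A x y * w y) \<ge> 0))"
proof -
  define a :: "'y + 'x \<Rightarrow> 'x \<Rightarrow> real" where
    "a = case_sum (\<lambda>y x. - A x y) (\<lambda>z x. if z = x then 1 else 0)"
  obtain w v where w: "\<forall>j\<in>Y <+> X. w j \<ge> 0" "\<forall>x\<in>X. (\<Sum>j\<in>Y <+> X. w j * a j x) = 0"
    and v: "\<forall>j\<in>Y <+> X. (\<Sum>x\<in>X. a j x * v x) \<ge> 0" "w (Inl y0) + (\<Sum>x\<in>X. a (Inl y0) x * v x) > 0"
    using tucker_alternative[OF finite_Plus[OF assms(2,1)] InlI[OF assms(3)] assms(1), of a]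
    by (elim exE conjE) (rule that)
  have dot_Inl: "(\<Sum>x\<in>X. a (Inl y) x * v x) = - (\<Sum>x\<in>X. v x * A x y)" for y
    by (simp add: a_def sum_negf mult.commute)
  have "v x \<ge> 0" if "x \<in> X" for x
  proof -
    have "(\<Sum>z\<in>X. a (Inr x) z * v z) = (\<Sum>z\<in>X. if x = z then v z else 0)"
      by (intro sum.cong) (auto simp: a_def)
    also have "\<dots> = v x" using that assms by simp
    finally show ?thesis using v(1) that by (metis InrI)
  qed
  moreover have "(\<Sum>x\<in>X. v x * A x y) \<le> 0" if "y \<in> Y" for y
    using v(1) that dot_Inl[of y] by (metis InlI neg_0_le_iff_le)
  moreover have "(\<Sum>y\<in>Y. A x y * w (Inl y)) \<ge> 0" if "x \<in> X" for x
  proof -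
    have "(\<Sum>z\<in>X. w (Inr z) * a (Inr z) x) = (\<Sum>z\<in>X. if z = x then w (Inr z) else 0)"
      by (intro sum.cong) (auto simp: a_def)
    also have "\<dots> = w (Inr x)" using that assms by simp
    finally have "0 = - (\<Sum>y\<in>Y. A x y * w (Inl y)) + w (Inr x)"
      using w(2) that assms by (simp add: sum.Plus a_def sum_negf mult.commute)
    then show ?thesis using w(1) that by (metis InrI add.commute add.right_inverse add_left_cancel)
  qed
  moreover have "w (Inl y) \<ge> 0" if "y \<in> Y" for y using w(1) that by blast
  ultimately have nonneg: "\<forall>x\<in>X. v x \<ge> 0" "\<forall>y\<in>Y. (\<Sum>x\<in>X. v x * A x y) \<le> 0"
    "\<forall>y\<in>Y. w (Inl y) \<ge> 0" "\<forall>x\<in>X. (\<Sum>y\<in>Y. A x y * w (Inl y)) \<ge> 0"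
    by simp_all
  have "w (Inl y0) > 0 \<or> (\<Sum>x\<in>X. v x * A x y0) < 0"
    using v(2) dot_Inl[of y0] by linarith
  then show ?thesis
  proof
    assume "w (Inl y0) > 0"
    with nonneg(3,4) show ?thesis
      by (intro disjI2 exI[of _ "\<lambda>y. w (Inl y)"] conjI)
  next
    assume "(\<Sum>x\<in>X. v x * A x y0) < 0"
    with nonneg(1,2) show ?thesis
      by (intro disjI1 exI[of _ v] conjI)
  qed
qed

section \<open>Distributions on finite sets\<close>

lemma pmf_of_weights:
  assumes "finite S" and "\<And>x. x \<in> S \<Longrightarrow> q x \<ge> 0" and "(\<Sum>x\<in>S. q x) = (1::real)"
  obtains p where "set_pmf p \<subseteq> S" and "\<And>x. x \<in> S \<Longrightarrow> pmf p x = q x"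
proof -
  let ?q = "\<lambda>x. if x \<in> S then q x else 0"
  have "(\<integral>\<^sup>+x. ennreal (?q x) \<partial>count_space UNIV) = (\<integral>\<^sup>+x. ennreal (q x) \<partial>count_space S)"
    by (subst nn_integral_count_space_indicator) (auto intro!: nn_integral_cong simp: indicator_def)
  also have "\<dots> = (\<Sum>x\<in>S. ennreal (q x))"
    using assms(1) by (rule nn_integral_count_space_finite)
  also have "\<dots> = 1"
    using assms by (simp add: sum_ennreal)
  finally have pmf: "pmf (embed_pmf ?q) x = ?q x" for x
    by (intro pmf_embed_pmf) (use assms in auto)
  show ?thesis
    by (rule that[of "embed_pmf ?q"]) (auto simp: set_pmf_eq pmf split: if_splits)
qed

lemma sum_pmf_eq_1_superset:
  assumes "finite S" "set_pmf p \<subseteq> S"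
  shows "(\<Sum>x\<in>S. pmf p x) = 1"
  using assms by (simp add: sum_pmf_eq_1)

lemma pmf_bind_finite:
  assumes "finite S" "set_pmf p \<subseteq> S"
  shows "pmf (bind_pmf p f) y = (\<Sum>x\<in>S. pmf p x * pmf (f x) y)"
  unfolding pmf_bind using assms
  by (subst integral_measure_pmf_real[of S]) (auto simp: mult.commute)

section \<open>Absorbing sets and stationary strategies\<close>

text \<open>
  The maximum principle: where \<open>f\<close> is maximal, its average under \<open>a x\<close> can reach
  \<open>f x\<close> only if \<open>f\<close> is maximal on the whole support of \<open>a x\<close>.
\<close>

lemma subharmonic_maximum_set_absorbing:
  assumes "finite S" "S \<noteq> {}" and plan: "\<And>x. x \<in> S \<Longrightarrow> set_pmf (a x) \<subseteq> S"
    and sub: "\<And>x. x \<in> S \<Longrightarrow> f x \<le> (\<Sum>y\<in>S. pmf (a x) y * f y)"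
  shows "absorbing S a {x \<in> S. f x = Max (f ` S)}"
  unfolding absorbing_def
proof (intro conjI ballI subsetI)
  have "Max (f ` S) \<in> f ` S"
    using assms by (intro Max_in) auto
  then show "{x \<in> S. f x = Max (f ` S)} \<noteq> {}" by force
next
  fix x y assume x: "x \<in> {x \<in> S. f x = Max (f ` S)}" and y: "y \<in> set_pmf (a x)"
  let ?M = "Max (f ` S)"
  have le: "f z \<le> ?M" if "z \<in> S" for z using assms(1) that by simp
  from x plan[of x] y have "y \<in> S" by auto
  have "(\<Sum>z\<in>S. pmf (a x) z * (?M - f z)) = ?M * (\<Sum>z\<in>S. pmf (a x) z) - (\<Sum>z\<in>S. pmf (a x) z * f z)"
    by (simp add: algebra_simps sum_subtractf sum_distrib_left)
  also have "\<dots> \<le> 0"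
    using x sub[of x] plan[of x] assms(1) by (simp add: sum_pmf_eq_1_superset)
  finally have "(\<Sum>z\<in>S. pmf (a x) z * (?M - f z)) = 0"
    using le by (intro antisym sum_nonneg) auto
  then have "pmf (a x) y * (?M - f y) = 0"
    using sum_nonneg_eq_0_iff[OF assms(1), of "\<lambda>z. pmf (a x) z * (?M - f z)"] le \<open>y \<in> S\<close> by auto
  with y \<open>y \<in> S\<close> show "y \<in> {x \<in> S. f x = ?M}"
    by (auto simp: set_pmf_iff)
qed (auto)

lemma minimal_absorbing_within:
  assumes "finite S" "absorbing S a A"
  obtains B where "B \<subseteq> A" "minimal_absorbing S a B"
proof -
  have fin: "finite {B. absorbing S a B \<and> B \<subseteq> A}"
  proof (rule finite_subset)
    show "{B. absorbing S a B \<and> B \<subseteq> A} \<subseteq> Pow S" by (auto simp: absorbing_def)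
  qed (use assms in simp)
  have "A \<in> {B. absorbing S a B \<and> B \<subseteq> A}"
    using assms by auto
  from finite_has_minimal2[OF fin this] obtain B where B: "absorbing S a B" "B \<subseteq> A"
    "\<And>B'. absorbing S a B' \<and> B' \<subseteq> A \<Longrightarrow> B' \<subseteq> B \<Longrightarrow> B = B'"
    by auto
  have "minimal_absorbing S a B"
    unfolding minimal_absorbing_def
  proof (intro conjI allI impI notI)
    fix B' assume "B' \<subset> B" "absorbing S a B'"
    then show False using B(2) B(3)[of B'] by auto
  qed fact
  then show ?thesis using B that by blast
qed

lemma minimal_absorbing_subset:
  assumes "minimal_absorbing S a B" "absorbing S a B'" "B' \<subseteq> B"
  shows "B' = B"
  using assms by (auto simp: minimal_absorbing_def psubset_eq)

lemma minimal_absorbing_eq: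
  assumes "minimal_absorbing S a B" "minimal_absorbing S a B'" "x \<in> B" "x \<in> B'"
  shows "B = B'"
proof -
  have "absorbing S a (B \<inter> B')"
    using assms unfolding minimal_absorbing_def absorbing_def by (auto dest: subsetD)
  then show ?thesis
    using minimal_absorbing_subset[OF assms(1), of "B \<inter> B'"]
      minimal_absorbing_subset[OF assms(2), of "B \<inter> B'"] by auto
qed

lemma minimal_absorbing_restrict:
  assumes "minimal_absorbing S a B"
  shows "minimal_absorbing B a B"
proof -
  have abs: "absorbing S a B" and min: "\<And>B'. B' \<subset> B \<Longrightarrow> \<not> absorbing S a B'"
    using assms by (simp_all add: minimal_absorbing_def)
  have "absorbing S a B'" if "absorbing B a B'" for B'
    using abs that by (auto simp: absorbing_def)
  moreover have "absorbing B a B"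
    using abs by (simp add: absorbing_def)
  ultimately show ?thesis
    using min by (auto simp: minimal_absorbing_def)
qed

text \<open>
  Tucker's lemma for the rows of \<open>a - id\<close> gives a nonnegative vector \<open>v\<close> annihilated by
  \<open>a - id\<close> and a subharmonic \<open>u\<close>, not harmonic at \<open>x0\<close> unless \<open>v x0 > 0\<close>.
  By the maximum principle and minimality \<open>u\<close> is constant, so \<open>v\<close> is nonzero and can be
  normalized.
\<close>

lemma stationary_exists:
  assumes S: "finite S" and B: "minimal_absorbing S a B"
  obtains s where "set_pmf s \<subseteq> B" "stationary a s"
proof -
  have abs: "absorbing S a B" using B by (simp add: minimal_absorbing_def)
  then have "B \<subseteq> S" "B \<noteq> {}" and plan: "\<And>x. x \<in> B \<Longrightarrow> set_pmf (a x) \<subseteq> B"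
    by (simp_all add: absorbing_def)
  then have fin: "finite B" using S by (simp add: finite_subset)
  obtain x0 where x0: "x0 \<in> B" using \<open>B \<noteq> {}\<close> by blast
  define A where "A x y = pmf (a x) y - (if y = x then 1 else 0)" for x y
  obtain v u where v: "\<forall>x\<in>B. v x \<ge> 0" "\<forall>y\<in>B. (\<Sum>x\<in>B. v x * A x y) = 0"
    and u: "\<forall>x\<in>B. (\<Sum>y\<in>B. A x y * u y) \<ge> 0" "v x0 + (\<Sum>y\<in>B. A x0 y * u y) > 0"
    using tucker_alternative[OF fin x0 fin, of A] by (elim exE conjE) (rule that)
  have Au: "(\<Sum>y\<in>B. A x y * u y) = (\<Sum>y\<in>B. pmf (a x) y * u y) - u x" if "x \<in> B" for x
  proof -
    have "(\<Sum>y\<in>B. A x y * u y) = (\<Sum>y\<in>B. pmf (a x) y * u y - (if y = x then u y else 0))"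
      by (intro sum.cong) (auto simp: A_def algebra_simps)
    then show ?thesis using that fin by (simp add: sum_subtractf)
  qed
  have "absorbing B a {x \<in> B. u x = Max (u ` B)}"
  proof (rule subharmonic_maximum_set_absorbing[OF fin \<open>B \<noteq> {}\<close> plan])
    show "u x \<le> (\<Sum>y\<in>B. pmf (a x) y * u y)" if "x \<in> B" for x
      using bspec[OF u(1) that] Au[OF that] by linarith
  qed
  then have "{x \<in> B. u x = Max (u ` B)} = B"
    using minimal_absorbing_restrict[OF B] by (intro minimal_absorbing_subset) auto
  then have const: "u y = Max (u ` B)" if "y \<in> B" for y using that by blast
  have "(\<Sum>y\<in>B. pmf (a x0) y * u y) = (\<Sum>y\<in>B. pmf (a x0) y * Max (u ` B))"
    by (intro sum.cong refl) (metis const)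
  also have "\<dots> = (\<Sum>y\<in>B. pmf (a x0) y) * Max (u ` B)"
    by (simp only: sum_distrib_right)
  also have "\<dots> = u x0" 
    using const[OF x0] sum_pmf_eq_1_superset[OF fin plan[OF x0]] by simp
  finally have "v x0 > 0" using u(2) Au[OF x0] by simp
  let ?V = "\<Sum>x\<in>B. v x"
  have V: "?V > 0"
    using fin x0 v(1) \<open>v x0 > 0\<close> by (intro sum_pos2[of _ x0]) auto
  obtain s where s: "set_pmf s \<subseteq> B" "\<And>x. x \<in> B \<Longrightarrow> pmf s x = v x / ?V"
  proof (rule pmf_of_weights[OF fin, of "\<lambda>x. v x / ?V"])
    show "v x / ?V \<ge> 0" if "x \<in> B" for x using that v(1) V by simp
    show "(\<Sum>x\<in>B. v x / ?V) = 1" using V by (simp add: sum_divide_distrib[symmetric])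
  qed (rule that)
  have "pmf (bind_pmf s a) y = pmf s y" for y
  proof (cases "y \<in> B")
    case True
    have "0 = (\<Sum>x\<in>B. v x * A x y)" using v(2) True by simp
    also have "\<dots> = (\<Sum>x\<in>B. v x * pmf (a x) y - (if y = x then v x else 0))"
      by (intro sum.cong) (auto simp: A_def algebra_simps)
    also have "\<dots> = (\<Sum>x\<in>B. v x * pmf (a x) y) - v y"
      using True fin by (simp add: sum_subtractf)
    finally have "(\<Sum>x\<in>B. v x * pmf (a x) y) = v y" by simp
    moreover have "pmf (bind_pmf s a) y = (\<Sum>x\<in>B. v x * pmf (a x) y) / ?V"
      by (simp add: pmf_bind_finite[OF fin s(1)] s(2) sum_divide_distrib)
    ultimately show ?thesis using s(2) True by simp
  next
    case False
    then have "y \<notin> set_pmf (bind_pmf s a)" "y \<notin> set_pmf s" using s(1) plan by auto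
    then show ?thesis by (metis set_pmf_iff)
  qed
  then have "stationary a s" unfolding stationary_def by (rule pmf_eqI)
  then show ?thesis using s that by blast
qed

lemma stationary_support_closed:
  assumes "stationary a s" "x \<in> set_pmf s"
  shows "set_pmf (a x) \<subseteq> set_pmf s"
proof -
  have "set_pmf (bind_pmf s a) = set_pmf s" using assms(1) by (simp add: stationary_def)
  then show ?thesis using assms(2) by auto
qed

lemma stationary_support:
  assumes "minimal_absorbing S a B" "stationary a s" "set_pmf s \<subseteq> B"
  shows "set_pmf s = B"
proof (rule minimal_absorbing_subset[OF assms(1)])
  show "absorbing S a (set_pmf s)"
    using assms(1,3) stationary_support_closed[OF assms(2)]
    unfolding minimal_absorbing_def absorbing_def by (simp add: set_pmf_not_empty subset_trans)
qed fact

text \<open>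
  Subtract from \<open>s\<close> the largest multiple of \<open>t\<close> that leaves a nonnegative invariant
  vector.  The set where this vector is positive is closed under the chain and misses a point of
  \<open>B\<close>, so by minimality it is empty.
\<close>

lemma stationary_unique:
  assumes S: "finite S" and B: "minimal_absorbing S a B"
    and s: "stationary a s" "set_pmf s \<subseteq> B" and t: "stationary a t" "set_pmf t \<subseteq> B"
  shows "s = t"
proof -
  have "B \<subseteq> S" "B \<noteq> {}" and plan: "\<And>x. x \<in> B \<Longrightarrow> set_pmf (a x) \<subseteq> B"
    using B by (simp_all add: minimal_absorbing_def absorbing_def)
  then have fin: "finite B" using S by (simp add: finite_subset)
  have pos: "pmf t x > 0" if "x \<in> B" for x
    using stationary_support[OF B t] that by (simp add: pmf_positive_iff)
  obtain z where z: "z \<in> B" "\<And>x. x \<in> B \<Longrightarrow> pmf s z / pmf t z \<le> pmf s x / pmf t x"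
    using arg_min_if_finite[OF fin \<open>B \<noteq> {}\<close>, of "\<lambda>x. pmf s x / pmf t x"]
    by (metis not_less)
  define k where "k = pmf s z / pmf t z"
  define g where "g x = pmf s x - k * pmf t x" for x
  have g_nonneg: "g x \<ge> 0" if "x \<in> B" for x
    using z(2)[OF that] pos[OF that] by (simp add: g_def k_def field_simps)
  have g_z: "g z = 0" using pos[OF z(1)] by (simp add: g_def k_def)
  have g_step: "g y = (\<Sum>x\<in>B. g x * pmf (a x) y)" for y
  proof -
    have "pmf s y = (\<Sum>x\<in>B. pmf s x * pmf (a x) y)" "pmf t y = (\<Sum>x\<in>B. pmf t x * pmf (a x) y)"
      using pmf_bind_finite[OF fin s(2), of a y] pmf_bind_finite[OF fin t(2), of a y] s t
      by (simp_all add: stationary_def)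
    then show ?thesis
      by (simp add: g_def algebra_simps sum_subtractf sum_distrib_left)
  qed
  have "\<not> absorbing S a {x \<in> B. g x > 0}"
  proof
    assume "absorbing S a {x \<in> B. g x > 0}"
    then have "{x \<in> B. g x > 0} = B" by (intro minimal_absorbing_subset[OF B]) auto
    with z(1) have "z \<in> {x \<in> B. g x > 0}" by (simp only:)
    with g_z show False by simp
  qed
  moreover have "y \<in> {x \<in> B. g x > 0}" if x: "x \<in> B" "g x > 0" and y: "y \<in> set_pmf (a x)" for x y
  proof -
    have "0 < g x * pmf (a x) y" using x y by (simp add: pmf_positive_iff)
    also have "\<dots> \<le> g y"
      unfolding g_step[of y] using x fin g_nonneg by (intro member_le_sum) auto
    finally show ?thesis using plan x y by auto
  qed
  ultimately have "{x \<in> B. g x > 0} = {}"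
    using \<open>B \<subseteq> S\<close> unfolding absorbing_def by (auto simp del: mem_Collect_eq)
  then have g0: "g x = 0" if "x \<in> B" for x
  proof -
    have "\<not> g x > 0" using \<open>{x \<in> B. g x > 0} = {}\<close> that by blast
    then show ?thesis using g_nonneg[OF that] by simp
  qed
  have "1 - k = (\<Sum>x\<in>B. g x)"
    using sum_pmf_eq_1_superset[OF fin s(2)] sum_pmf_eq_1_superset[OF fin t(2)]
    by (simp add: g_def sum_subtractf sum_distrib_left[symmetric])
  then have "k = 1" using g0 by simp
  show ?thesis
  proof (intro pmf_eqI)
    fix x show "pmf s x = pmf t x"
    proof (cases "x \<in> B")
      case True
      then show ?thesis using g0[of x] \<open>k = 1\<close> by (simp add: g_def)
    next
      case False
      then have "x \<notin> set_pmf s" "x \<notin> set_pmf t" using s(2) t(2) by auto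
      then show ?thesis by (simp add: set_pmf_iff)
    qed
  qed
qed

lemma reduced_strategies_nonempty:
  assumes "finite S" "S \<noteq> {}" and "\<And>x. x \<in> S \<Longrightarrow> set_pmf (a x) \<subseteq> S"
  shows "reduced_strategies S a \<noteq> {}"
proof -
  have "absorbing S a S" using assms by (simp add: absorbing_def)
  then obtain B where B: "minimal_absorbing S a B"
    using assms(1) minimal_absorbing_within by metis
  then obtain s where "set_pmf s \<subseteq> B" "stationary a s"
    using assms(1) stationary_exists by metis
  then show ?thesis using B by (auto simp: reduced_strategies_def)
qed

lemma reduced_strategies_support:
  "s \<in> reduced_strategies S a \<Longrightarrow> set_pmf s \<subseteq> S"
  unfolding reduced_strategies_def minimal_absorbing_def absorbing_def by blast

text \<open>
  Different minimal absorbing sets are disjoint, and each carries one stationary strategy.  This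
  bounds the number of reduced strategies through systems of representatives.
\<close>

lemma reduced_strategies_disjoint:
  assumes "finite S" "s \<in> reduced_strategies S a" "t \<in> reduced_strategies S a"
    and "x \<in> set_pmf s" "x \<in> set_pmf t"
  shows "s = t"
proof -
  obtain B C where B: "minimal_absorbing S a B" "stationary a s" "set_pmf s \<subseteq> B"
    and C: "minimal_absorbing S a C" "stationary a t" "set_pmf t \<subseteq> C"
    using assms(2,3) by (auto simp: reduced_strategies_def)
  have "B = C" using minimal_absorbing_eq[OF B(1) C(1)] B(3) C(3) assms(4,5) by blast
  then show ?thesis using stationary_unique[OF assms(1) B] C by blast
qed

lemma reduced_strategies_transversal:
  assumes "finite S" and h: "\<And>s. s \<in> reduced_strategies S a \<Longrightarrow> h s \<in> set_pmf s"
  shows "inj_on h (reduced_strategies S a)" and "h ` reduced_strategies S a \<subseteq> S"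
proof -
  show "inj_on h (reduced_strategies S a)"
  proof (rule inj_onI)
    fix s t assume s: "s \<in> reduced_strategies S a" and t: "t \<in> reduced_strategies S a"
      and "h s = h t"
    then show "s = t"
      using reduced_strategies_disjoint[OF assms(1) s t h[OF s]] h[OF t] by simp
  qed
  show "h ` reduced_strategies S a \<subseteq> S"
    using h reduced_strategies_support by blast
qed

lemma finite_reduced_strategies:
  assumes "finite S"
  shows "finite (reduced_strategies S a)"
proof -
  let ?h = "\<lambda>s. SOME x. x \<in> set_pmf s"
  have h: "?h s \<in> set_pmf s" for s :: "'a pmf" by (simp add: some_in_eq set_pmf_not_empty)
  show ?thesis
    by (rule inj_on_finite[OF reduced_strategies_transversal[OF assms h] assms])
qed

lemma card_reduced_strategies_le:
  assumes "finite S"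
  shows "card (reduced_strategies S a) \<le> card S"
proof -
  let ?h = "\<lambda>s. SOME x. x \<in> set_pmf s"
  have h: "?h s \<in> set_pmf s" for s :: "'a pmf" by (simp add: some_in_eq set_pmf_not_empty)
  show ?thesis
    by (rule card_inj_on_le[OF reduced_strategies_transversal[OF assms h] assms])
qed

text \<open>
  A strategy \<open>x\<close> that is moved elsewhere with positive probability is never alone in the support
  of a stationary strategy, so representatives can be chosen to avoid it.
\<close>

lemma card_reduced_strategies_less:
  assumes "finite S" "x \<in> S" "y \<noteq> x" "pmf (a x) y > 0"
  shows "card (reduced_strategies S a) < card S"
proof -
  have "\<exists>z. z \<in> set_pmf s \<and> z \<noteq> x" if s: "s \<in> reduced_strategies S a" for s
  proof (rule ccontr)
    assume "\<nexists>z. z \<in> set_pmf s \<and> z \<noteq> x"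
    then have "set_pmf s \<subseteq> {x}" by (simp add: subset_iff)
    then have "set_pmf s = {x}" using set_pmf_not_empty[of s] by (simp add: subset_singleton_iff)
    moreover have "stationary a s" using s by (auto simp: reduced_strategies_def)
    ultimately have "set_pmf (a x) \<subseteq> {x}" using stationary_support_closed[of a s x] by simp
    then show False using assms(3,4) by (auto simp: pmf_positive_iff)
  qed
  then obtain h where h: "\<And>s. s \<in> reduced_strategies S a \<Longrightarrow> h s \<in> set_pmf s \<and> h s \<noteq> x"
    by metis
  then have "inj_on h (reduced_strategies S a)" "h ` reduced_strategies S a \<subseteq> S - {x}"
    using reduced_strategies_transversal[OF assms(1), of a h] by auto
  then have "card (reduced_strategies S a) \<le> card (S - {x})"
    using assms(1) by (intro card_inj_on_le) auto
  also have "\<dots> < card S" using assms(1,2) by (intro psubset_card_mono) auto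
  finally show ?thesis .
qed

text \<open>
  Some reduced strategy lives on the set where \<open>f\<close> is maximal.  Hence a reduced strategy that
  is optimal among the reduced ones has expected payoff equal to that maximum, and so attains it at
  each point of its support.
\<close>

lemma reduced_strategies_best_payoff:
  assumes "finite S" and plan: "\<And>x. x \<in> S \<Longrightarrow> set_pmf (a x) \<subseteq> S"
    and sub: "\<And>x. x \<in> S \<Longrightarrow> f x \<le> (\<Sum>y\<in>S. pmf (a x) y * f y)"
    and r: "r \<in> reduced_strategies S a"
    and best: "\<And>r'. r' \<in> reduced_strategies S a \<Longrightarrow>
       (\<Sum>y\<in>S. pmf r' y * f y) \<le> (\<Sum>y\<in>S. pmf r y * f y)"
    and x: "x \<in> set_pmf r" and y: "y \<in> S"
  shows "f y \<le> f x"
proof -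
  let ?M = "Max (f ` S)"
  have le: "f z \<le> ?M" if "z \<in> S" for z using assms(1) that by simp
  have "absorbing S a {x \<in> S. f x = ?M}"
    by (rule subharmonic_maximum_set_absorbing[OF assms(1) _ plan sub]) (use y in auto)
  then obtain B where B: "B \<subseteq> {x \<in> S. f x = ?M}" "minimal_absorbing S a B"
    using minimal_absorbing_within assms(1) by metis
  then obtain r' where r': "set_pmf r' \<subseteq> B" "stationary a r'"
    using stationary_exists assms(1) by metis
  have "r' \<in> reduced_strategies S a" using B r' by (auto simp: reduced_strategies_def)
  have "?M = (\<Sum>y\<in>S. pmf r' y * ?M)"
    using sum_pmf_eq_1_superset[OF assms(1) reduced_strategies_support[OF \<open>r' \<in> _\<close>]]
    by (simp add: sum_distrib_right[symmetric])
  also have "\<dots> = (\<Sum>y\<in>S. pmf r' y * f y)"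
  proof (intro sum.cong refl)
    fix y
    have "f y = ?M \<or> y \<notin> set_pmf r'" using r'(1) B(1) by blast
    then show "pmf r' y * ?M = pmf r' y * f y" by (auto simp: set_pmf_iff)
  qed
  also have "\<dots> \<le> (\<Sum>y\<in>S. pmf r y * f y)" by (rule best) fact
  finally have "?M \<le> (\<Sum>y\<in>S. pmf r y * f y)" .
  moreover have "(\<Sum>y\<in>S. pmf r y * (?M - f y)) = ?M - (\<Sum>y\<in>S. pmf r y * f y)"
    using sum_pmf_eq_1_superset[OF assms(1) reduced_strategies_support[OF r]]
    by (simp add: right_diff_distrib sum_subtractf sum_distrib_right[symmetric])
  ultimately have "(\<Sum>y\<in>S. pmf r y * (?M - f y)) = 0"
    using le by (intro antisym sum_nonneg) auto
  then have "pmf r x * (?M - f x) = 0"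
    using sum_nonneg_eq_0_iff[OF assms(1), of "\<lambda>y. pmf r y * (?M - f y)"] le x
      reduced_strategies_support[OF r] by auto
  then show ?thesis using x le[OF y] by (simp add: set_pmf_iff)
qed

section \<open>Switches and incentive constraints\<close>

lemma finite_gameD:
  assumes "finite_game \<Gamma>"
  shows "finite (players \<Gamma>)" "players \<Gamma> \<noteq> {}"
    "i \<in> players \<Gamma> \<Longrightarrow> finite (strategies \<Gamma> i)" "i \<in> players \<Gamma> \<Longrightarrow> strategies \<Gamma> i \<noteq> {}"
    "finite (profiles \<Gamma>)" "finite (profiles_without \<Gamma> i)" "profiles \<Gamma> \<noteq> {}"
  using assms by (auto simp: finite_game_def profiles_def profiles_without_def PiE_eq_empty_iff
      intro!: finite_PiE)

lemma profile_upd: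
  assumes "c \<in> profiles \<Gamma>" "i \<in> players \<Gamma>" "d \<in> strategies \<Gamma> i"
  shows "c(i := d) \<in> profiles \<Gamma>"
  using assms by (auto simp: profiles_def PiE_def Pi_def extensional_def)

lemma profile_without_upd:
  assumes "c \<in> profiles_without \<Gamma> i" "i \<in> players \<Gamma>" "d \<in> strategies \<Gamma> i"
  shows "c(i := d) \<in> profiles \<Gamma>"
  using assms by (auto simp: profiles_def profiles_without_def PiE_def Pi_def extensional_def)

lemma sum_profiles_split:
  assumes "finite_game \<Gamma>" "i \<in> players \<Gamma>"
  shows "(\<Sum>c\<in>profiles \<Gamma>. g c) =
    (\<Sum>d\<in>strategies \<Gamma> i. \<Sum>c\<in>profiles_without \<Gamma> i. g (c(i := d)))"
proof -
  have P: "insert i (players \<Gamma> - {i}) = players \<Gamma>" using assms(2) by auto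
  have "(\<Sum>c\<in>profiles \<Gamma>. g c) =
      (\<Sum>(d, c)\<in>strategies \<Gamma> i \<times> profiles_without \<Gamma> i. g (c(i := d)))"
  proof (rule sum.reindex_cong[of "\<lambda>(d, c). c(i := d)"])
    show "profiles \<Gamma> = (\<lambda>(d, c). c(i := d)) ` (strategies \<Gamma> i \<times> profiles_without \<Gamma> i)"
      using PiE_insert_eq[of i "players \<Gamma> - {i}" "strategies \<Gamma>"]
      by (simp only: P profiles_def profiles_without_def split_def)
    show "inj_on (\<lambda>(d, c). c(i := d)) (strategies \<Gamma> i \<times> profiles_without \<Gamma> i)"
    proof (intro inj_onI, clarsimp)
      fix d c d' c'
      assume c: "c \<in> profiles_without \<Gamma> i" "c' \<in> profiles_without \<Gamma> i"
        and eq: "c(i := d) = c'(i := d')"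
      have "c j = c' j" for j
        using c fun_cong[OF eq, of j]
        by (cases "j = i") (auto simp: profiles_without_def PiE_def extensional_def)
      then show "d = d' \<and> c = c'" using fun_cong[OF eq, of i] by auto
    qed
  qed auto
  then show ?thesis by (simp add: sum.cartesian_product)
qed

text \<open>
  A triple \<open>(i, x, y)\<close> indexes the incentive constraint that keeps player \<open>i\<close> from
  playing \<open>y\<close> when told \<open>x\<close>.  With \<open>switch_gain\<close> as coefficient matrix, indexed by
  profiles and triples, the constraints become linear inequalities on the weights of profiles.
\<close>

definition switch_gain :: "('i, 's) game \<Rightarrow> ('i \<Rightarrow> 's) \<Rightarrow> 'i \<times> 's \<times> 's \<Rightarrow> real" where
  "switch_gain \<Gamma> c = (\<lambda>(i, x, y). if c i = x then utility \<Gamma> i (c(i := y)) - utility \<Gamma> i c else 0)"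

definition switches :: "('i, 's) game \<Rightarrow> ('i \<times> 's \<times> 's) set" where
  "switches \<Gamma> = (SIGMA i : players \<Gamma>. strategies \<Gamma> i \<times> strategies \<Gamma> i)"

lemma finite_switches: "finite_game \<Gamma> \<Longrightarrow> finite (switches \<Gamma>)"
  by (auto simp: switches_def finite_game_def)

lemma switches_iff:
  "(i, x, y) \<in> switches \<Gamma> \<longleftrightarrow> i \<in> players \<Gamma> \<and> x \<in> strategies \<Gamma> i \<and> y \<in> strategies \<Gamma> i"
  by (auto simp: switches_def)

lemma switch_gain_refl: "switch_gain \<Gamma> c (i, x, x) = 0"
  by (auto simp: switch_gain_def)

lemma deviation_gain_eq:
  assumes "finite_game \<Gamma>" "(i, x, y) \<in> switches \<Gamma>"
  shows "deviation_gain \<Gamma> \<mu> i x y = (\<Sum>c\<in>profiles \<Gamma>. pmf \<mu> c * switch_gain \<Gamma> c (i, x, y))"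
proof -
  have i: "i \<in> players \<Gamma>" "x \<in> strategies \<Gamma> i" using assms(2) by (auto simp: switches_iff)
  have "(\<Sum>c\<in>profiles \<Gamma>. pmf \<mu> c * switch_gain \<Gamma> c (i, x, y)) =
     (\<Sum>d\<in>strategies \<Gamma> i. if d = x then deviation_gain \<Gamma> \<mu> i x y else 0)"
    unfolding sum_profiles_split[OF assms(1) i(1)]
    by (intro sum.cong) (auto simp: switch_gain_def deviation_gain_def)
  then show ?thesis using finite_gameD(3)[OF assms(1) i(1)] i(2) by simp
qed

lemma correlated_equilibrium_iff:
  assumes "finite_game \<Gamma>"
  shows "correlated_equilibrium \<Gamma> \<mu> \<longleftrightarrow> set_pmf \<mu> \<subseteq> profiles \<Gamma> \<and>
     (\<forall>t\<in>switches \<Gamma>. (\<Sum>c\<in>profiles \<Gamma>. pmf \<mu> c * switch_gain \<Gamma> c t) \<le> 0)"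
  unfolding correlated_equilibrium_def
  using deviation_gain_eq[OF assms, of _ _ _ \<mu>] by (auto simp: switches_def)

lemma correlated_equilibrium_of_weights:
  assumes \<Gamma>: "finite_game \<Gamma>" and "\<And>c. c \<in> profiles \<Gamma> \<Longrightarrow> v c \<ge> 0" and V: "(\<Sum>c\<in>profiles \<Gamma>. v c) > 0"
    and gain: "\<And>t. t \<in> switches \<Gamma> \<Longrightarrow> (\<Sum>c\<in>profiles \<Gamma>. v c * switch_gain \<Gamma> c t) \<le> 0"
  obtains \<mu> where "correlated_equilibrium \<Gamma> \<mu>"
    and "\<And>c. c \<in> profiles \<Gamma> \<Longrightarrow> pmf \<mu> c = v c / (\<Sum>c\<in>profiles \<Gamma>. v c)"
proof -
  let ?V = "\<Sum>c\<in>profiles \<Gamma>. v c"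
  obtain \<mu> where \<mu>: "set_pmf \<mu> \<subseteq> profiles \<Gamma>" "\<And>c. c \<in> profiles \<Gamma> \<Longrightarrow> pmf \<mu> c = v c / ?V"
  proof (rule pmf_of_weights[of "profiles \<Gamma>" "\<lambda>c. v c / ?V"])
    show "finite (profiles \<Gamma>)" using finite_gameD(5)[OF \<Gamma>] .
    show "v c / ?V \<ge> 0" if "c \<in> profiles \<Gamma>" for c using assms(2)[OF that] V by simp
    show "(\<Sum>c\<in>profiles \<Gamma>. v c / ?V) = 1" using V by (simp add: sum_divide_distrib[symmetric])
  qed (rule that)
  have "(\<Sum>c\<in>profiles \<Gamma>. pmf \<mu> c * switch_gain \<Gamma> c t) \<le> 0" if "t \<in> switches \<Gamma>" for t
  proof -
    have "(\<Sum>c\<in>profiles \<Gamma>. pmf \<mu> c * switch_gain \<Gamma> c t) =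
        (\<Sum>c\<in>profiles \<Gamma>. v c * switch_gain \<Gamma> c t) / ?V"
      by (simp add: \<mu>(2) sum_divide_distrib)
    then show ?thesis using gain[OF that] V by (simp add: divide_nonpos_pos)
  qed
  then show ?thesis
    using \<mu> that correlated_equilibrium_iff[OF \<Gamma>] by blast
qed

section \<open>Independent randomization\<close>

lemma pmf_product_distribution:
  assumes "finite_game \<Gamma>" "c \<in> profiles \<Gamma>"
  shows "pmf (product_distribution \<Gamma> s) c = (\<Prod>j\<in>players \<Gamma>. pmf (s j) (c j))"
  unfolding product_distribution_def using assms
  by (intro pmf_Pi') (auto simp: finite_gameD profiles_def PiE_def extensional_def)

lemma set_product_distribution:
  assumes "finite_game \<Gamma>" "\<And>j. j \<in> players \<Gamma> \<Longrightarrow> set_pmf (s j) \<subseteq> strategies \<Gamma> j"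
  shows "set_pmf (product_distribution \<Gamma> s) \<subseteq> profiles \<Gamma>"
  unfolding product_distribution_def using assms
  by (auto simp: finite_gameD set_Pi_pmf PiE_dflt_def profiles_def PiE_def extensional_def)

lemma product_distribution_cong:
  assumes "\<And>j. j \<in> players \<Gamma> \<Longrightarrow> s j = t j"
  shows "product_distribution \<Gamma> s = product_distribution \<Gamma> t"
  unfolding product_distribution_def using assms by (intro Pi_pmf_cong) auto

lemma product_distribution_component:
  assumes "finite_game \<Gamma>" "j \<in> players \<Gamma>"
  shows "map_pmf (\<lambda>c. c j) (product_distribution \<Gamma> s) = s j"
  unfolding product_distribution_def using assms by (simp add: Pi_pmf_component finite_gameD)

text \<open>
  The value of \<open>s\<close> at \<open>i\<close> itself does not enter, so these numbers are the
  coefficients of the payoff of \<open>i\<close> as a linear function of the strategy of \<open>i\<close>.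
\<close>

definition payoff_against :: "('i, 's) game \<Rightarrow> ('i \<Rightarrow> 's pmf) \<Rightarrow> 'i \<Rightarrow> 's \<Rightarrow> real" where
  "payoff_against \<Gamma> s i d =
     (\<Sum>c\<in>profiles_without \<Gamma> i. (\<Prod>j\<in>players \<Gamma> - {i}. pmf (s j) (c j)) * utility \<Gamma> i (c(i := d)))"

lemma payoff_against_upd [simp]: "payoff_against \<Gamma> (s(i := x)) i = payoff_against \<Gamma> s i"
proof -
  have "(\<Prod>j\<in>players \<Gamma> - {i}. pmf ((s(i := x)) j) (c j)) = (\<Prod>j\<in>players \<Gamma> - {i}. pmf (s j) (c j))" for c
    by (intro prod.cong) auto
  then show ?thesis by (simp only: payoff_against_def fun_eq_iff) simp
qed

lemma prod_upd_split:
  assumes "finite_game \<Gamma>" "i \<in> players \<Gamma>"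
  shows "(\<Prod>j\<in>players \<Gamma>. pmf (s j) ((c(i := d)) j)) =
    pmf (s i) d * (\<Prod>j\<in>players \<Gamma> - {i}. pmf (s j) (c j))"
proof -
  have "(\<Prod>j\<in>players \<Gamma>. pmf (s j) ((c(i := d)) j)) =
      pmf (s i) d * (\<Prod>j\<in>players \<Gamma> - {i}. pmf (s j) ((c(i := d)) j))"
    using prod.remove[OF finite_gameD(1)[OF assms(1)] assms(2), of "\<lambda>j. pmf (s j) ((c(i := d)) j)"]
    by simp
  also have "(\<Prod>j\<in>players \<Gamma> - {i}. pmf (s j) ((c(i := d)) j)) = (\<Prod>j\<in>players \<Gamma> - {i}. pmf (s j) (c j))"
    by (intro prod.cong) auto
  finally show ?thesis .
qed

text \<open>
  Conditioning on the strategy of player \<open>i\<close>: the general form serves both for payoffs and for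
  the expected effect of a deviation plan \<open>h\<close>.
\<close>

lemma sum_product_distribution:
  assumes "finite_game \<Gamma>" "i \<in> players \<Gamma>"
  shows "(\<Sum>c\<in>profiles \<Gamma>. pmf (product_distribution \<Gamma> s) c * (\<Sum>d\<in>D. h (c i) d * utility \<Gamma> i (c(i := d)))) =
    (\<Sum>x\<in>strategies \<Gamma> i. pmf (s i) x * (\<Sum>d\<in>D. h x d * payoff_against \<Gamma> s i d))"
proof -
  have "(\<Sum>c\<in>profiles_without \<Gamma> i. pmf (product_distribution \<Gamma> s) (c(i := x)) *
        (\<Sum>d\<in>D. h x d * utility \<Gamma> i (c(i := d)))) =
      pmf (s i) x * (\<Sum>d\<in>D. h x d * payoff_against \<Gamma> s i d)"
    if x: "x \<in> strategies \<Gamma> i" for x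
  proof -
    have "(\<Sum>c\<in>profiles_without \<Gamma> i. pmf (product_distribution \<Gamma> s) (c(i := x)) *
          (\<Sum>d\<in>D. h x d * utility \<Gamma> i (c(i := d)))) =
       (\<Sum>c\<in>profiles_without \<Gamma> i. \<Sum>d\<in>D. pmf (s i) x * (h x d *
          ((\<Prod>j\<in>players \<Gamma> - {i}. pmf (s j) (c j)) * utility \<Gamma> i (c(i := d)))))"
    proof (intro sum.cong refl)
      fix c assume "c \<in> profiles_without \<Gamma> i"
      then have "c(i := x) \<in> profiles \<Gamma>" using assms(2) x by (rule profile_without_upd)
      then show "pmf (product_distribution \<Gamma> s) (c(i := x)) * (\<Sum>d\<in>D. h x d * utility \<Gamma> i (c(i := d))) =
        (\<Sum>d\<in>D. pmf (s i) x * (h x d * ((\<Prod>j\<in>players \<Gamma> - {i}. pmf (s j) (c j)) * utility \<Gamma> i (c(i := d)))))"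
        unfolding pmf_product_distribution[OF assms(1) \<open>c(i := x) \<in> _\<close>] prod_upd_split[OF assms]
        by (simp add: sum_distrib_left mult_ac)
    qed
    also have "\<dots> = pmf (s i) x * (\<Sum>d\<in>D. h x d * payoff_against \<Gamma> s i d)"
      by (subst sum.swap) (simp add: payoff_against_def sum_distrib_left)
    finally show ?thesis .
  qed
  then show ?thesis
    unfolding sum_profiles_split[OF assms] by (intro sum.cong) auto
qed

lemma mixed_utility_sum:
  assumes "finite_game \<Gamma>" "\<And>j. j \<in> players \<Gamma> \<Longrightarrow> set_pmf (s j) \<subseteq> strategies \<Gamma> j"
  shows "mixed_utility \<Gamma> i s = (\<Sum>c\<in>profiles \<Gamma>. pmf (product_distribution \<Gamma> s) c * utility \<Gamma> i c)"
proof -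
  have "mixed_utility \<Gamma> i s = (\<Sum>c\<in>profiles \<Gamma>. utility \<Gamma> i c * pmf (product_distribution \<Gamma> s) c)"
    unfolding mixed_utility_def using set_product_distribution[OF assms] finite_gameD[OF assms(1)]
    by (intro integral_measure_pmf_real) auto
  then show ?thesis by (simp add: mult.commute)
qed

lemma sum_product_distribution_utility:
  assumes "finite_game \<Gamma>" "i \<in> players \<Gamma>"
  shows "(\<Sum>c\<in>profiles \<Gamma>. pmf (product_distribution \<Gamma> s) c * utility \<Gamma> i c) =
    (\<Sum>x\<in>strategies \<Gamma> i. pmf (s i) x * payoff_against \<Gamma> s i x)"
proof -
  have delta: "(\<Sum>d\<in>strategies \<Gamma> i. (if d = x then 1 else 0) * f d) = f x"
    if "x \<in> strategies \<Gamma> i" for x and f :: "'b \<Rightarrow> real"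
  proof -
    have "(\<Sum>d\<in>strategies \<Gamma> i. (if d = x then 1 else 0) * f d) = (\<Sum>d\<in>strategies \<Gamma> i. if d = x then f d else 0)"
      by (intro sum.cong) auto
    then show ?thesis using that finite_gameD(3)[OF assms] by simp
  qed
  have "(\<Sum>c\<in>profiles \<Gamma>. pmf (product_distribution \<Gamma> s) c * utility \<Gamma> i c) =
    (\<Sum>c\<in>profiles \<Gamma>. pmf (product_distribution \<Gamma> s) c *
       (\<Sum>d\<in>strategies \<Gamma> i. (if d = c i then 1 else 0) * utility \<Gamma> i (c(i := d))))"
  proof (intro sum.cong refl)
    fix c assume "c \<in> profiles \<Gamma>"
    then have "c i \<in> strategies \<Gamma> i" using assms(2) by (auto simp: profiles_def)
    then show "pmf (product_distribution \<Gamma> s) c * utility \<Gamma> i c = pmf (product_distribution \<Gamma> s) c *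
       (\<Sum>d\<in>strategies \<Gamma> i. (if d = c i then 1 else 0) * utility \<Gamma> i (c(i := d)))"
      by (simp only: delta) simp
  qed
  also have "\<dots> = (\<Sum>x\<in>strategies \<Gamma> i. pmf (s i) x *
      (\<Sum>d\<in>strategies \<Gamma> i. (if d = x then 1 else 0) * payoff_against \<Gamma> s i d))"
    by (rule sum_product_distribution[OF assms, of s "\<lambda>x d. if d = x then 1 else 0"])
  also have "\<dots> = (\<Sum>x\<in>strategies \<Gamma> i. pmf (s i) x * payoff_against \<Gamma> s i x)"
    by (intro sum.cong refl) (simp only: delta)
  finally show ?thesis .
qed

lemma mixed_utility_eq:
  assumes "finite_game \<Gamma>" "\<And>j. j \<in> players \<Gamma> \<Longrightarrow> set_pmf (s j) \<subseteq> strategies \<Gamma> j" "i \<in> players \<Gamma>"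
  shows "mixed_utility \<Gamma> i s = (\<Sum>d\<in>strategies \<Gamma> i. pmf (s i) d * payoff_against \<Gamma> s i d)"
  using mixed_utility_sum[OF assms(1,2)] sum_product_distribution_utility[OF assms(1,3)] by simp

text \<open>
  Under independent play the recommendation tells a player nothing about the others, so the gain of a
  switch factors.
\<close>

lemma deviation_gain_product:
  assumes "finite_game \<Gamma>" "(i, x, y) \<in> switches \<Gamma>"
  shows "deviation_gain \<Gamma> (product_distribution \<Gamma> s) i x y =
    pmf (s i) x * (payoff_against \<Gamma> s i y - payoff_against \<Gamma> s i x)"
proof -
  have i: "i \<in> players \<Gamma>" "x \<in> strategies \<Gamma> i" using assms(2) by (auto simp: switches_iff)
  have "deviation_gain \<Gamma> (product_distribution \<Gamma> s) i x y =
     (\<Sum>c\<in>profiles_without \<Gamma> i. pmf (s i) x * ((\<Prod>j\<in>players \<Gamma> - {i}. pmf (s j) (c j)) *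
        utility \<Gamma> i (c(i := y)) - (\<Prod>j\<in>players \<Gamma> - {i}. pmf (s j) (c j)) * utility \<Gamma> i (c(i := x))))"
    unfolding deviation_gain_def
  proof (intro sum.cong refl)
    fix c assume "c \<in> profiles_without \<Gamma> i"
    then have "c(i := x) \<in> profiles \<Gamma>" using i by (rule profile_without_upd)
    from pmf_product_distribution[OF assms(1) this, of s] prod_upd_split[OF assms(1) i(1), of s c x]
    show "pmf (product_distribution \<Gamma> s) (c(i := x)) * (utility \<Gamma> i (c(i := y)) - utility \<Gamma> i (c(i := x))) =
      pmf (s i) x * ((\<Prod>j\<in>players \<Gamma> - {i}. pmf (s j) (c j)) *
        utility \<Gamma> i (c(i := y)) - (\<Prod>j\<in>players \<Gamma> - {i}. pmf (s j) (c j)) * utility \<Gamma> i (c(i := x)))"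
      by (simp add: algebra_simps)
  qed
  then show ?thesis
    by (simp add: payoff_against_def sum_subtractf sum_distrib_left right_diff_distrib)
qed

lemma nash_of_product_equilibrium:
  assumes \<Gamma>: "finite_game \<Gamma>" and s: "s \<in> mixed_profiles \<Gamma>"
    and ce: "correlated_equilibrium \<Gamma> (product_distribution \<Gamma> s)"
  shows "nash_equilibrium \<Gamma> s"
  unfolding nash_equilibrium_def
proof (intro conjI ballI)
  have supp: "set_pmf (s j) \<subseteq> strategies \<Gamma> j" if "j \<in> players \<Gamma>" for j
    using PiE_mem[OF s[unfolded mixed_profiles_def] that] by (simp add: mixed_strategies_def)
  fix i \<tau> assume i: "i \<in> players \<Gamma>" and \<tau>: "\<tau> \<in> mixed_strategies \<Gamma> i"
  let ?S = "strategies \<Gamma> i" and ?f = "payoff_against \<Gamma> s i"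
  have fin: "finite ?S" using finite_gameD(3)[OF \<Gamma> i] .
  have best: "?f y \<le> ?f x" if "x \<in> set_pmf (s i)" "y \<in> ?S" for x y
  proof -
    have "(i, x, y) \<in> switches \<Gamma>" using supp[OF i] that i by (auto simp: switches_iff)
    then have "pmf (s i) x * (?f y - ?f x) \<le> 0"
      using ce deviation_gain_product[OF \<Gamma> \<open>(i, x, y) \<in> _\<close>, of s, symmetric]
      by (simp add: correlated_equilibrium_def switches_iff)
    moreover have "pmf (s i) x > 0" using that(1) by (simp add: pmf_positive_iff)
    ultimately show ?thesis by (simp add: mult_le_0_iff)
  qed
  obtain z where z: "z \<in> set_pmf (s i)" using set_pmf_not_empty[of "s i"] by auto
  have "mixed_utility \<Gamma> i (s(i := \<tau>)) = (\<Sum>d\<in>?S. pmf \<tau> d * ?f d)"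
    using mixed_utility_eq[OF \<Gamma>, of "s(i := \<tau>)" i] supp \<tau> i by (auto simp: mixed_strategies_def)
  also have "\<dots> \<le> (\<Sum>d\<in>?S. pmf \<tau> d * ?f z)"
    using best[OF z] by (intro sum_mono mult_left_mono) auto
  also have "\<dots> = ?f z"
    using sum_pmf_eq_1_superset[OF fin, of \<tau>] \<tau> by (simp add: sum_distrib_right[symmetric] mixed_strategies_def)
  also have "\<dots> = (\<Sum>d\<in>?S. pmf (s i) d * ?f z)"
    using sum_pmf_eq_1_superset[OF fin supp[OF i]] by (simp add: sum_distrib_right[symmetric])
  also have "\<dots> \<le> (\<Sum>d\<in>?S. pmf (s i) d * ?f d)"
  proof (intro sum_mono)
    fix d assume "d \<in> ?S"
    show "pmf (s i) d * ?f z \<le> pmf (s i) d * ?f d"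
    proof (cases "d \<in> set_pmf (s i)")
      case True
      have "z \<in> ?S" using z supp[OF i] by blast
      then show ?thesis using best[OF True] by (simp add: mult_left_mono)
    qed (simp add: set_pmf_iff)
  qed
  also have "\<dots> = mixed_utility \<Gamma> i s"
    using mixed_utility_eq[OF \<Gamma> supp i] by simp
  finally show "mixed_utility \<Gamma> i (s(i := \<tau>)) \<le> mixed_utility \<Gamma> i s" .
qed fact

section \<open>Equilibria of a reduced game induce equilibria\<close>

lemma correlated_equilibrium_bind:
  assumes \<Gamma>: "finite_game \<Gamma>" and fin: "finite P" "set_pmf \<nu> \<subseteq> P"
    and supp: "\<And>s. s \<in> set_pmf \<nu> \<Longrightarrow> set_pmf (f s) \<subseteq> profiles \<Gamma>"
    and gain: "\<And>i x y. (i, x, y) \<in> switches \<Gamma> \<Longrightarrow>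
       (\<Sum>s\<in>P. pmf \<nu> s * deviation_gain \<Gamma> (f s) i x y) \<le> 0"
  shows "correlated_equilibrium \<Gamma> (bind_pmf \<nu> f)"
  unfolding correlated_equilibrium_def
proof (intro conjI ballI)
  show "set_pmf (bind_pmf \<nu> f) \<subseteq> profiles \<Gamma>" using supp by auto
  fix i x y assume "i \<in> players \<Gamma>" "x \<in> strategies \<Gamma> i" "y \<in> strategies \<Gamma> i"
  then have t: "(i, x, y) \<in> switches \<Gamma>" by (simp add: switches_iff)
  have "deviation_gain \<Gamma> (bind_pmf \<nu> f) i x y =
     (\<Sum>c\<in>profiles_without \<Gamma> i. \<Sum>s\<in>P. pmf \<nu> s * (pmf (f s) (c(i := x)) *
        (utility \<Gamma> i (c(i := y)) - utility \<Gamma> i (c(i := x)))))"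
    unfolding deviation_gain_def pmf_bind_finite[OF fin]
    by (simp only: sum_distrib_right mult.assoc)
  also have "\<dots> = (\<Sum>s\<in>P. pmf \<nu> s * deviation_gain \<Gamma> (f s) i x y)"
    by (subst sum.swap) (simp only: deviation_gain_def sum_distrib_left)
  also have "\<dots> \<le> 0" using gain[OF t] .
  finally show "deviation_gain \<Gamma> (bind_pmf \<nu> f) i x y \<le> 0" .
qed

lemma deviation_planD:
  assumes "deviation_plan \<Gamma> i a" "x \<in> strategies \<Gamma> i"
  shows "set_pmf (a x) \<subseteq> strategies \<Gamma> i"
  using assms by (auto simp: deviation_plan_def mixed_strategies_def)

lemma dual_vector_plan:
  assumes "dual_vector \<Gamma> \<alpha>" "i \<in> players \<Gamma>" "x \<in> strategies \<Gamma> i"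
  shows "set_pmf (\<alpha> i x) \<subseteq> strategies \<Gamma> i"
  using assms deviation_planD[of \<Gamma> i] by (simp add: dual_vector_def)

lemma payoff_against_pure:
  assumes "finite_game \<Gamma>" "c \<in> profiles \<Gamma>" "i \<in> players \<Gamma>" "d \<in> strategies \<Gamma> i"
  shows "payoff_against \<Gamma> (\<lambda>j. return_pmf (c j)) i d = utility \<Gamma> i (c(i := d))"
proof -
  let ?s = "\<lambda>j. return_pmf ((c(i := d)) j)"
  have supp: "set_pmf (?s j) \<subseteq> strategies \<Gamma> j" if "j \<in> players \<Gamma>" for j
    using profile_upd[OF assms(2-4)] that by (auto simp: profiles_def PiE_def Pi_def)
  have "c(i := d) \<in> extensional (players \<Gamma>)"
    using profile_upd[OF assms(2-4)] by (simp add: profiles_def PiE_def)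
  then have "(\<lambda>j. if j \<in> players \<Gamma> then (c(i := d)) j else undefined) = c(i := d)"
    by (intro ext) (auto simp: extensional_def)
  then have "product_distribution \<Gamma> ?s = return_pmf (c(i := d))"
    using Pi_pmf_return_pmf[OF finite_gameD(1)[OF assms(1)], of undefined "c(i := d)"]
    by (simp only: product_distribution_def)
  then have "mixed_utility \<Gamma> i ?s = utility \<Gamma> i (c(i := d))"
    by (simp add: mixed_utility_def)
  moreover have "mixed_utility \<Gamma> i ?s = (\<Sum>x\<in>strategies \<Gamma> i. pmf (?s i) x * payoff_against \<Gamma> ?s i x)"
    using mixed_utility_eq[OF assms(1) supp assms(3)] .
  moreover have "\<dots> = (\<Sum>x\<in>strategies \<Gamma> i. if x = d then payoff_against \<Gamma> ?s i x else 0)"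
    by (intro sum.cong) (auto simp: indicator_def)
  moreover have "\<dots> = payoff_against \<Gamma> ?s i d"
    using finite_gameD(3)[OF assms(1,3)] assms(4) by simp
  moreover have "?s = (\<lambda>j. return_pmf (c j))(i := return_pmf d)" by auto
  ultimately show ?thesis by (metis payoff_against_upd)
qed

lemma dual_vector_iff:
  assumes \<Gamma>: "finite_game \<Gamma>"
  shows "dual_vector \<Gamma> \<alpha> \<longleftrightarrow> (\<forall>i\<in>players \<Gamma>. deviation_plan \<Gamma> i (\<alpha> i)) \<and>
    (\<forall>c\<in>profiles \<Gamma>. (\<Sum>i\<in>players \<Gamma>. \<Sum>d\<in>strategies \<Gamma> i.
       pmf (\<alpha> i (c i)) d * (utility \<Gamma> i (c(i := d)) - utility \<Gamma> i c)) \<ge> 0)"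
proof -
  have "mixed_utility \<Gamma> i ((\<lambda>j. return_pmf (c j))(i := \<alpha> i (c i))) - utility \<Gamma> i c =
    (\<Sum>d\<in>strategies \<Gamma> i. pmf (\<alpha> i (c i)) d * (utility \<Gamma> i (c(i := d)) - utility \<Gamma> i c))"
    if plan: "deviation_plan \<Gamma> i (\<alpha> i)" and c: "c \<in> profiles \<Gamma>" and i: "i \<in> players \<Gamma>" for i c
  proof -
    let ?s = "(\<lambda>j. return_pmf (c j))(i := \<alpha> i (c i))"
    have cS: "c j \<in> strategies \<Gamma> j" if "j \<in> players \<Gamma>" for j
      using c that by (auto simp: profiles_def)
    note plan_c = deviation_planD[OF plan cS[OF i]]
    have "mixed_utility \<Gamma> i ?s = (\<Sum>d\<in>strategies \<Gamma> i. pmf (?s i) d * payoff_against \<Gamma> ?s i d)"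
      using cS plan_c i by (intro mixed_utility_eq[OF \<Gamma>]) auto
    also have "\<dots> = (\<Sum>d\<in>strategies \<Gamma> i. pmf (\<alpha> i (c i)) d * utility \<Gamma> i (c(i := d)))"
      using payoff_against_pure[OF \<Gamma> c i] by (intro sum.cong) auto
    finally show ?thesis
      using sum_pmf_eq_1_superset[OF finite_gameD(3)[OF \<Gamma> i] plan_c]
      by (simp add: right_diff_distrib sum_subtractf sum_distrib_right[symmetric])
  qed
  then show ?thesis unfolding dual_vector_def by (auto cong: sum.cong)
qed

text \<open>
  Average the inequality of the dual vector over the profiles in which \<open>i\<close> plays \<open>x\<close> and the
  others play \<open>t\<close>.  The deviation of an opponent whose strategy is stationary leaves
  the distribution of the profile unchanged, so only the contribution of \<open>i\<close> survives.
\<close>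

lemma dual_vector_subharmonic:
  assumes \<Gamma>: "finite_game \<Gamma>" and \<alpha>: "dual_vector \<Gamma> \<alpha>" and i: "i \<in> players \<Gamma>"
    and supp: "\<And>j. j \<in> players \<Gamma> \<Longrightarrow> j \<noteq> i \<Longrightarrow> set_pmf (t j) \<subseteq> strategies \<Gamma> j"
    and stat: "\<And>j. j \<in> players \<Gamma> \<Longrightarrow> j \<noteq> i \<Longrightarrow> stationary (\<alpha> j) (t j)"
    and x: "x \<in> strategies \<Gamma> i"
  shows "payoff_against \<Gamma> t i x \<le> (\<Sum>d\<in>strategies \<Gamma> i. pmf (\<alpha> i x) d * payoff_against \<Gamma> t i d)"
proof -
  define s where "s = t(i := return_pmf x)"
  let ?pd = "product_distribution \<Gamma> s"
  \<comment> \<open>The expected gain of player \<open>j\<close> from following the deviation plan.\<close>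
  define diff where "diff j = (\<Sum>y\<in>strategies \<Gamma> j. pmf (s j) y *
      (\<Sum>d\<in>strategies \<Gamma> j. pmf (\<alpha> j y) d * payoff_against \<Gamma> s j d))
    - (\<Sum>y\<in>strategies \<Gamma> j. pmf (s j) y * payoff_against \<Gamma> s j y)" for j
  have "0 \<le> (\<Sum>c\<in>profiles \<Gamma>. pmf ?pd c * (\<Sum>j\<in>players \<Gamma>. \<Sum>d\<in>strategies \<Gamma> j.
       pmf (\<alpha> j (c j)) d * (utility \<Gamma> j (c(j := d)) - utility \<Gamma> j c)))"
    using \<alpha> by (intro sum_nonneg[of "profiles \<Gamma>"] mult_nonneg_nonneg)
      (simp_all add: dual_vector_iff[OF \<Gamma>])
  also have "\<dots> = (\<Sum>j\<in>players \<Gamma>. \<Sum>c\<in>profiles \<Gamma>. pmf ?pd c * (\<Sum>d\<in>strategies \<Gamma> j.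
       pmf (\<alpha> j (c j)) d * (utility \<Gamma> j (c(j := d)) - utility \<Gamma> j c)))"
    by (subst sum.swap) (simp only: sum_distrib_left)
  also have "\<dots> = (\<Sum>j\<in>players \<Gamma>. diff j)"
  proof (intro sum.cong refl)
    fix j assume j: "j \<in> players \<Gamma>"
    have "(\<Sum>c\<in>profiles \<Gamma>. pmf ?pd c * (\<Sum>d\<in>strategies \<Gamma> j.
       pmf (\<alpha> j (c j)) d * (utility \<Gamma> j (c(j := d)) - utility \<Gamma> j c))) =
      (\<Sum>c\<in>profiles \<Gamma>. pmf ?pd c * (\<Sum>d\<in>strategies \<Gamma> j. pmf (\<alpha> j (c j)) d * utility \<Gamma> j (c(j := d))) -
         pmf ?pd c * utility \<Gamma> j c)"
    proof (intro sum.cong refl)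
      fix c assume "c \<in> profiles \<Gamma>"
      then have "c j \<in> strategies \<Gamma> j" using j by (auto simp: profiles_def)
      then have "(\<Sum>d\<in>strategies \<Gamma> j. pmf (\<alpha> j (c j)) d) = 1"
        using dual_vector_plan[OF \<alpha> j] by (intro sum_pmf_eq_1_superset[OF finite_gameD(3)[OF \<Gamma> j]]) simp
      then have "(\<Sum>d\<in>strategies \<Gamma> j. pmf (\<alpha> j (c j)) d * (utility \<Gamma> j (c(j := d)) - utility \<Gamma> j c)) =
        (\<Sum>d\<in>strategies \<Gamma> j. pmf (\<alpha> j (c j)) d * utility \<Gamma> j (c(j := d))) - utility \<Gamma> j c"
        by (simp add: right_diff_distrib sum_subtractf sum_distrib_right[symmetric])
      then show "pmf ?pd c * (\<Sum>d\<in>strategies \<Gamma> j. pmf (\<alpha> j (c j)) d * (utility \<Gamma> j (c(j := d)) - utility \<Gamma> j c))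
        = pmf ?pd c * (\<Sum>d\<in>strategies \<Gamma> j. pmf (\<alpha> j (c j)) d * utility \<Gamma> j (c(j := d))) -
         pmf ?pd c * utility \<Gamma> j c"
        by (simp only: right_diff_distrib)
    qed
    also have "\<dots> = diff j"
      unfolding sum_subtractf diff_def
        sum_product_distribution[OF \<Gamma> j, where s = s and h = "\<lambda>y. pmf (\<alpha> j y)"]
        sum_product_distribution_utility[OF \<Gamma> j] ..
    finally show "(\<Sum>c\<in>profiles \<Gamma>. pmf ?pd c * (\<Sum>d\<in>strategies \<Gamma> j.
       pmf (\<alpha> j (c j)) d * (utility \<Gamma> j (c(j := d)) - utility \<Gamma> j c))) = diff j" .
  qed
  also have "\<dots> = diff i"
  proof -
    have "diff j = 0" if j: "j \<in> players \<Gamma> - {i}" for j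
    proof -
      have j': "j \<in> players \<Gamma>" "j \<noteq> i" using j by auto
      then have sj: "s j = t j" by (simp add: s_def)
      have step: "pmf (t j) d = (\<Sum>y\<in>strategies \<Gamma> j. pmf (t j) y * pmf (\<alpha> j y) d)" for d
        using pmf_bind_finite[OF finite_gameD(3)[OF \<Gamma> j'(1)] supp[OF j'], of "\<alpha> j" d] stat[OF j']
        by (simp add: stationary_def)
      have "(\<Sum>y\<in>strategies \<Gamma> j. pmf (s j) y *
          (\<Sum>d\<in>strategies \<Gamma> j. pmf (\<alpha> j y) d * payoff_against \<Gamma> s j d)) =
        (\<Sum>d\<in>strategies \<Gamma> j. (\<Sum>y\<in>strategies \<Gamma> j. pmf (t j) y * pmf (\<alpha> j y) d) * payoff_against \<Gamma> s j d)"
        unfolding sj sum_distrib_left sum_distrib_right mult.assoc by (rule sum.swap)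
      then show ?thesis by (simp only: diff_def sj step[symmetric] diff_self)
    qed
    then show ?thesis
      using sum.remove[OF finite_gameD(1)[OF \<Gamma>] i, of diff] by simp
  qed
  also have "diff i = (\<Sum>d\<in>strategies \<Gamma> i. pmf (\<alpha> i x) d * payoff_against \<Gamma> t i d) - payoff_against \<Gamma> t i x"
  proof -
    have "(\<Sum>y\<in>strategies \<Gamma> i. pmf (s i) y * g y) = g x" for g
    proof -
      have "(\<Sum>y\<in>strategies \<Gamma> i. pmf (s i) y * g y) = (\<Sum>y\<in>strategies \<Gamma> i. if y = x then g y else 0)"
        by (intro sum.cong) (auto simp: s_def indicator_def)
      then show ?thesis using x finite_gameD(3)[OF \<Gamma> i] by simp
    qed
    then show ?thesis unfolding diff_def by (simp add: s_def)
  qed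
  finally show ?thesis by simp
qed

lemma reduced_game_simps [simp]:
  "players (reduced_game \<Gamma> \<alpha>) = players \<Gamma>"
  "utility (reduced_game \<Gamma> \<alpha>) = mixed_utility \<Gamma>"
  "i \<in> players \<Gamma> \<Longrightarrow> strategies (reduced_game \<Gamma> \<alpha>) i = reduced_strategies (strategies \<Gamma> i) (\<alpha> i)"
  by (simp_all add: reduced_game_def)

lemma finite_game_reduced:
  assumes "finite_game \<Gamma>" "dual_vector \<Gamma> \<alpha>"
  shows "finite_game (reduced_game \<Gamma> \<alpha>)"
  using assms dual_vector_plan[OF assms(2)]
  by (auto simp: finite_game_def finite_reduced_strategies reduced_strategies_nonempty)

lemma reduced_profile_mixed:
  assumes "s \<in> profiles (reduced_game \<Gamma> \<alpha>)" "i \<in> players \<Gamma>"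
  shows "set_pmf (s i) \<subseteq> strategies \<Gamma> i" "stationary (\<alpha> i) (s i)"
proof -
  have "s i \<in> reduced_strategies (strategies \<Gamma> i) (\<alpha> i)"
    using assms PiE_mem[of s "players \<Gamma>" "strategies (reduced_game \<Gamma> \<alpha>)" i] by (simp add: profiles_def)
  then show "set_pmf (s i) \<subseteq> strategies \<Gamma> i" "stationary (\<alpha> i) (s i)"
    using reduced_strategies_support by (auto simp: reduced_strategies_def)
qed

text \<open>
  The gain from a switch \<open>x\<close> to \<open>y\<close> splits over the reduced strategies \<open>r\<close> that may
  have been recommended to \<open>i\<close>.  Given \<open>r\<close>, the payoff of \<open>i\<close> against the
  conditional play of the others is subharmonic, and \<open>r\<close> is optimal for it among the reduced
  strategies by the equilibrium condition of the reduced game.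
\<close>

lemma reduced_equilibrium_induces_equilibrium:
  assumes \<Gamma>: "finite_game \<Gamma>" and \<alpha>: "dual_vector \<Gamma> \<alpha>"
    and \<nu>: "correlated_equilibrium (reduced_game \<Gamma> \<alpha>) \<nu>"
  shows "correlated_equilibrium \<Gamma> (bind_pmf \<nu> (product_distribution \<Gamma>))"
proof (rule correlated_equilibrium_bind[OF \<Gamma>])
  let ?H = "reduced_game \<Gamma> \<alpha>"
  have H: "finite_game ?H" using finite_game_reduced[OF \<Gamma> \<alpha>] .
  show "finite (profiles ?H)" using finite_gameD(5)[OF H] .
  show supp: "set_pmf \<nu> \<subseteq> profiles ?H" using \<nu> by (simp add: correlated_equilibrium_def)
  show "set_pmf (product_distribution \<Gamma> s) \<subseteq> profiles \<Gamma>" if "s \<in> set_pmf \<nu>" for s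
    using that supp reduced_profile_mixed(1)[of s \<Gamma> \<alpha>] by (intro set_product_distribution[OF \<Gamma>]) blast
  fix i x y assume sw: "(i, x, y) \<in> switches \<Gamma>"
  then have i: "i \<in> players \<Gamma>" and x: "x \<in> strategies \<Gamma> i" and y: "y \<in> strategies \<Gamma> i"
    by (auto simp: switches_iff)
  define R where "R = reduced_strategies (strategies \<Gamma> i) (\<alpha> i)"
  let ?S = "strategies \<Gamma> i"
  have fin: "finite ?S" using finite_gameD(3)[OF \<Gamma> i] .
  let ?W = "profiles_without ?H i"
  \<comment> \<open>The payoff of \<open>d\<close> when \<open>r\<close> is recommended, weighted by the probability
    of that recommendation.\<close>
  define f where "f r d = (\<Sum>t\<in>?W. pmf \<nu> (t(i := r)) * payoff_against \<Gamma> t i d)" for r d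
  have tR: "t(i := r) \<in> profiles ?H" if "t \<in> ?W" "r \<in> R" for t r
    using that i by (intro profile_without_upd) (auto simp: R_def)
  have "(\<Sum>s\<in>profiles ?H. pmf \<nu> s * deviation_gain \<Gamma> (product_distribution \<Gamma> s) i x y) =
      (\<Sum>r\<in>R. \<Sum>t\<in>?W. pmf \<nu> (t(i := r)) * (pmf r x * (payoff_against \<Gamma> t i y - payoff_against \<Gamma> t i x)))"
    using i unfolding deviation_gain_product[OF \<Gamma> sw] by (subst sum_profiles_split[OF H, of i]) (simp_all add: R_def)
  also have "\<dots> = (\<Sum>r\<in>R. pmf r x * (f r y - f r x))"
    by (intro sum.cong refl)
      (simp add: f_def sum_subtractf[symmetric] sum_distrib_left right_diff_distrib mult_ac)
  also have "\<dots> \<le> 0"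
  proof (intro sum_nonpos)
    fix r assume r: "r \<in> R"
    show "pmf r x * (f r y - f r x) \<le> 0"
    proof (cases "x \<in> set_pmf r")
      case True
      have "f r y \<le> f r x"
      proof (rule reduced_strategies_best_payoff[OF fin dual_vector_plan[OF \<alpha> i], of _ "f r" r])
        fix z assume z: "z \<in> ?S"
        have "f r z \<le> (\<Sum>t\<in>?W. pmf \<nu> (t(i := r)) * (\<Sum>d\<in>?S. pmf (\<alpha> i z) d * payoff_against \<Gamma> t i d))"
          unfolding f_def
        proof (intro sum_mono mult_left_mono)
          fix t assume t: "t \<in> ?W"
          have "set_pmf (t j) \<subseteq> strategies \<Gamma> j \<and> stationary (\<alpha> j) (t j)" if "j \<in> players \<Gamma>" "j \<noteq> i" for j
            using reduced_profile_mixed[OF tR[OF t r] that(1)] that(2) by simp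
          then show "payoff_against \<Gamma> t i z \<le> (\<Sum>d\<in>?S. pmf (\<alpha> i z) d * payoff_against \<Gamma> t i d)"
            using z by (intro dual_vector_subharmonic[OF \<Gamma> \<alpha> i]) auto
        qed simp
        also have "\<dots> = (\<Sum>d\<in>?S. pmf (\<alpha> i z) d * f r d)"
          unfolding f_def sum_distrib_left by (subst sum.swap) (simp only: mult.left_commute)
        finally show "f r z \<le> (\<Sum>d\<in>?S. pmf (\<alpha> i z) d * f r d)" .
      next
        fix r' assume "r' \<in> reduced_strategies ?S (\<alpha> i)"
        then have r': "r' \<in> R" by (simp add: R_def)
        have pay: "(\<Sum>t\<in>?W. pmf \<nu> (t(i := r)) * mixed_utility \<Gamma> i (t(i := q))) = (\<Sum>d\<in>?S. pmf q d * f r d)"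
          if q: "q \<in> R" for q
        proof -
          have "(\<Sum>t\<in>?W. pmf \<nu> (t(i := r)) * mixed_utility \<Gamma> i (t(i := q))) =
             (\<Sum>t\<in>?W. pmf \<nu> (t(i := r)) * (\<Sum>d\<in>?S. pmf q d * payoff_against \<Gamma> t i d))"
          proof (intro sum.cong refl)
            fix t assume t: "t \<in> ?W"
            show "pmf \<nu> (t(i := r)) * mixed_utility \<Gamma> i (t(i := q)) =
                pmf \<nu> (t(i := r)) * (\<Sum>d\<in>?S. pmf q d * payoff_against \<Gamma> t i d)"
              using mixed_utility_eq[OF \<Gamma> _ i, of "t(i := q)"] reduced_profile_mixed(1)[OF tR[OF t q]]
              by simp
          qed
          also have "\<dots> = (\<Sum>d\<in>?S. pmf q d * f r d)"
            unfolding f_def sum_distrib_left by (subst sum.swap) (simp only: mult.left_commute)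
          finally show ?thesis .
        qed
        have "deviation_gain ?H \<nu> i r r' \<le> 0"
          using \<nu> r r' i by (auto simp: correlated_equilibrium_def R_def)
        then show "(\<Sum>d\<in>?S. pmf r' d * f r d) \<le> (\<Sum>d\<in>?S. pmf r d * f r d)"
          using pay[OF r] pay[OF r']
          by (simp add: deviation_gain_def right_diff_distrib sum_subtractf)
      qed (use r True y in \<open>simp_all add: R_def\<close>)
      then show ?thesis by (simp add: mult_nonneg_nonpos)
    qed (simp add: set_pmf_iff)
  qed
  finally show "(\<Sum>s\<in>profiles ?H. pmf \<nu> s * deviation_gain \<Gamma> (product_distribution \<Gamma> s) i x y) \<le> 0" .
qed

section \<open>Complementarity of equilibria and dual vectors\<close>

text \<open>
  Dual vectors up to scaling: nonnegative weights become transition probabilities after division by a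
  number that exceeds all row sums, the missing mass being put on the diagonal, where deviating
  brings no gain.
\<close>

lemma dual_vector_of_weights:
  assumes \<Gamma>: "finite_game \<Gamma>" and w: "\<And>i x y. (i, x, y) \<in> switches \<Gamma> \<Longrightarrow> w i x y \<ge> (0::real)"
    and ineq: "\<And>c. c \<in> profiles \<Gamma> \<Longrightarrow> (\<Sum>i\<in>players \<Gamma>. \<Sum>d\<in>strategies \<Gamma> i.
       w i (c i) d * (utility \<Gamma> i (c(i := d)) - utility \<Gamma> i c)) \<ge> 0"
  obtains \<alpha> where "dual_vector \<Gamma> \<alpha>"
    and "\<And>i x y. (i, x, y) \<in> switches \<Gamma> \<Longrightarrow> w i x y > 0 \<or> y = x \<Longrightarrow> pmf (\<alpha> i x) y > 0"
proof -
  let ?S = "strategies \<Gamma>"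
  define M where "M = 1 + (\<Sum>i\<in>players \<Gamma>. \<Sum>x\<in>?S i. \<Sum>y\<in>?S i. w i x y)"
  have row_nonneg: "(\<Sum>y\<in>?S i. w i x y) \<ge> 0" if "i \<in> players \<Gamma>" "x \<in> ?S i" for i x
    using that w by (intro sum_nonneg) (auto simp: switches_iff)
  have block_nonneg: "(\<Sum>x\<in>?S i. \<Sum>y\<in>?S i. w i x y) \<ge> 0" if "i \<in> players \<Gamma>" for i
    using row_nonneg[OF that] by (rule sum_nonneg)
  have row: "(\<Sum>y\<in>?S i. w i x y) < M" if i: "i \<in> players \<Gamma>" and x: "x \<in> ?S i" for i x
  proof -
    have "(\<Sum>y\<in>?S i. w i x y) \<le> (\<Sum>x\<in>?S i. \<Sum>y\<in>?S i. w i x y)"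
      using member_le_sum[OF x, of "\<lambda>x. \<Sum>y\<in>?S i. w i x y"] row_nonneg[OF i] finite_gameD(3)[OF \<Gamma> i] by simp
    also have "\<dots> \<le> (\<Sum>i\<in>players \<Gamma>. \<Sum>x\<in>?S i. \<Sum>y\<in>?S i. w i x y)"
      using member_le_sum[OF i, of "\<lambda>i. \<Sum>x\<in>?S i. \<Sum>y\<in>?S i. w i x y"] block_nonneg
        finite_gameD(1)[OF \<Gamma>] by simp
    finally show ?thesis by (simp add: M_def)
  qed
  have M: "M > 0"
    unfolding M_def using block_nonneg by (intro add_pos_nonneg sum_nonneg[of "players \<Gamma>"]) auto
  define q where "q i x y = w i x y / M + (if y = x then 1 - (\<Sum>y\<in>?S i. w i x y) / M else 0)" for i x y
  have "\<exists>p. set_pmf p \<subseteq> ?S i \<and> (\<forall>y\<in>?S i. pmf p y = q i x y)" if i: "i \<in> players \<Gamma>" and x: "x \<in> ?S i" for i x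
  proof -
    have fin: "finite (?S i)" using finite_gameD(3)[OF \<Gamma> i] .
    have "q i x y \<ge> 0" if "y \<in> ?S i" for y
      using w[of i x y] i x that row[OF i x] M by (simp add: q_def switches_iff)
    moreover have "(\<Sum>y\<in>?S i. q i x y) = 1"
      using x fin by (simp add: q_def sum.distrib sum_divide_distrib[symmetric])
    ultimately show ?thesis using pmf_of_weights[OF fin, of "q i x"] by metis
  qed
  then obtain \<alpha> where \<alpha>: "\<And>i x. i \<in> players \<Gamma> \<Longrightarrow> x \<in> ?S i \<Longrightarrow>
      set_pmf (\<alpha> i x) \<subseteq> ?S i \<and> (\<forall>y\<in>?S i. pmf (\<alpha> i x) y = q i x y)"
    by metis
  have "dual_vector \<Gamma> \<alpha>"
    unfolding dual_vector_iff[OF \<Gamma>]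
  proof (intro conjI ballI)
    show "deviation_plan \<Gamma> i (\<alpha> i)" if "i \<in> players \<Gamma>" for i
      using \<alpha> that by (simp add: deviation_plan_def mixed_strategies_def)
    fix c assume c: "c \<in> profiles \<Gamma>"
    have "(\<Sum>i\<in>players \<Gamma>. \<Sum>d\<in>?S i. pmf (\<alpha> i (c i)) d * (utility \<Gamma> i (c(i := d)) - utility \<Gamma> i c)) =
      (\<Sum>i\<in>players \<Gamma>. \<Sum>d\<in>?S i. w i (c i) d * (utility \<Gamma> i (c(i := d)) - utility \<Gamma> i c) / M)"
    proof (intro sum.cong refl)
      fix i d assume i: "i \<in> players \<Gamma>" and d: "d \<in> ?S i"
      then have "c i \<in> ?S i" using c by (auto simp: profiles_def)
      then show "pmf (\<alpha> i (c i)) d * (utility \<Gamma> i (c(i := d)) - utility \<Gamma> i c) =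
          w i (c i) d * (utility \<Gamma> i (c(i := d)) - utility \<Gamma> i c) / M"
        using \<alpha>[OF i, of "c i"] d by (simp add: q_def)
    qed
    also have "\<dots> = (\<Sum>i\<in>players \<Gamma>. \<Sum>d\<in>?S i. w i (c i) d * (utility \<Gamma> i (c(i := d)) - utility \<Gamma> i c)) / M"
      by (simp only: sum_divide_distrib)
    also have "\<dots> \<ge> 0" using ineq[OF c] M by simp
    finally show "(\<Sum>i\<in>players \<Gamma>. \<Sum>d\<in>?S i. pmf (\<alpha> i (c i)) d * (utility \<Gamma> i (c(i := d)) - utility \<Gamma> i c)) \<ge> 0" .
  qed
  moreover have "pmf (\<alpha> i x) y > 0" if sw: "(i, x, y) \<in> switches \<Gamma>" and pos: "w i x y > 0 \<or> y = x" for i x y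
  proof -
    have i: "i \<in> players \<Gamma>" "x \<in> ?S i" "y \<in> ?S i" using sw by (auto simp: switches_iff)
    have "q i x y > 0"
      using w[OF sw] row[OF i(1,2)] pos M by (auto simp: q_def add_nonneg_pos)
    then show ?thesis using \<alpha>[OF i(1,2)] i(3) by simp
  qed
  ultimately show ?thesis using that by blast
qed

lemma dual_vector_exists:
  assumes "finite_game \<Gamma>"
  obtains \<alpha> where "dual_vector \<Gamma> \<alpha>"
  by (rule dual_vector_of_weights[OF assms, of "\<lambda>_ _ _. 0"]) (auto intro: that)

text \<open>
  The inequality for weights is preserved by sums, so it suffices to add up, over all triples, dual
  vectors that are positive there whenever some dual vector is.
\<close>

lemma full_dual_vector_exists:
  assumes \<Gamma>: "finite_game \<Gamma>"
  obtains \<alpha> where "full_dual_vector \<Gamma> \<alpha>"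
proof -
  have "\<exists>\<beta>. dual_vector \<Gamma> \<beta> \<and>
      ((\<exists>\<gamma>. dual_vector \<Gamma> \<gamma> \<and> pmf (\<gamma> (fst t) (fst (snd t))) (snd (snd t)) > 0) \<longrightarrow>
        pmf (\<beta> (fst t) (fst (snd t))) (snd (snd t)) > 0)" for t
    using dual_vector_exists[OF \<Gamma>] by metis
  then obtain \<beta> where \<beta>: "\<And>t. dual_vector \<Gamma> (\<beta> t)"
    "\<And>t \<gamma>. dual_vector \<Gamma> \<gamma> \<Longrightarrow> pmf (\<gamma> (fst t) (fst (snd t))) (snd (snd t)) > 0 \<Longrightarrow>
        pmf (\<beta> t (fst t) (fst (snd t))) (snd (snd t)) > 0"
    by metis
  define w where "w i x y = (\<Sum>t\<in>switches \<Gamma>. pmf (\<beta> t i x) y)" for i x y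
  obtain \<alpha> where \<alpha>: "dual_vector \<Gamma> \<alpha>"
    "\<And>i x y. (i, x, y) \<in> switches \<Gamma> \<Longrightarrow> w i x y > 0 \<or> y = x \<Longrightarrow> pmf (\<alpha> i x) y > 0"
  proof (rule dual_vector_of_weights[OF \<Gamma>, of w])
    show "w i x y \<ge> 0" for i x y unfolding w_def by (intro sum_nonneg) simp
    fix c assume c: "c \<in> profiles \<Gamma>"
    have "(\<Sum>i\<in>players \<Gamma>. \<Sum>d\<in>strategies \<Gamma> i. w i (c i) d * (utility \<Gamma> i (c(i := d)) - utility \<Gamma> i c)) =
       (\<Sum>i\<in>players \<Gamma>. \<Sum>t\<in>switches \<Gamma>. \<Sum>d\<in>strategies \<Gamma> i.
         pmf (\<beta> t i (c i)) d * (utility \<Gamma> i (c(i := d)) - utility \<Gamma> i c))"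
      unfolding w_def sum_distrib_right by (intro sum.cong refl sum.swap)
    also have "\<dots> = (\<Sum>t\<in>switches \<Gamma>. \<Sum>i\<in>players \<Gamma>. \<Sum>d\<in>strategies \<Gamma> i.
         pmf (\<beta> t i (c i)) d * (utility \<Gamma> i (c(i := d)) - utility \<Gamma> i c))"
      by (rule sum.swap)
    also have "\<dots> \<ge> 0"
      using \<beta>(1) c by (intro sum_nonneg[of "switches \<Gamma>"]) (simp add: dual_vector_iff[OF \<Gamma>])
    finally show "(\<Sum>i\<in>players \<Gamma>. \<Sum>d\<in>strategies \<Gamma> i. w i (c i) d * (utility \<Gamma> i (c(i := d)) - utility \<Gamma> i c)) \<ge> 0" .
  qed (rule that)
  have "pmf (\<alpha> i x) y > 0" if sw: "(i, x, y) \<in> switches \<Gamma>" and \<gamma>: "dual_vector \<Gamma> \<gamma>" "pmf (\<gamma> i x) y > 0" for i x y \<gamma>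
  proof -
    have "0 < pmf (\<beta> (i, x, y) i x) y" using \<beta>(2)[OF \<gamma>(1), of "(i, x, y)"] \<gamma>(2) by simp
    also have "\<dots> \<le> w i x y"
      unfolding w_def by (rule member_le_sum[OF sw _ finite_switches[OF \<Gamma>]]) simp
    finally show ?thesis using \<alpha>(2)[OF sw] by simp
  qed
  then have "full_dual_vector \<Gamma> \<alpha>"
    using \<alpha>(1) by (auto simp: full_dual_vector_def switches_iff)
  then show ?thesis by (rule that)
qed

text \<open>
  Farkas' lemma for the matrix of switch gains.  The first alternative is a correlated equilibrium up
  to normalization.
\<close>

lemma switch_complementarity:
  assumes \<Gamma>: "finite_game \<Gamma>" and t0: "(i, x, y) \<in> switches \<Gamma>"
  shows "(\<exists>v. (\<forall>c\<in>profiles \<Gamma>. v c \<ge> 0) \<and>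
      (\<forall>t\<in>switches \<Gamma>. (\<Sum>c\<in>profiles \<Gamma>. v c * switch_gain \<Gamma> c t) \<le> 0) \<and>
      (\<Sum>c\<in>profiles \<Gamma>. v c * switch_gain \<Gamma> c (i, x, y)) < 0) \<or>
    (\<exists>\<alpha>. dual_vector \<Gamma> \<alpha> \<and> pmf (\<alpha> i x) y > 0)"
  using farkas_alternative[OF finite_gameD(5)[OF \<Gamma>] finite_switches[OF \<Gamma>] t0, of "switch_gain \<Gamma>"]
proof
  assume "\<exists>w. (\<forall>t\<in>switches \<Gamma>. w t \<ge> 0) \<and> w (i, x, y) > 0 \<and>
    (\<forall>c\<in>profiles \<Gamma>. (\<Sum>t\<in>switches \<Gamma>. switch_gain \<Gamma> c t * w t) \<ge> 0)"
  then obtain w where w: "\<forall>t\<in>switches \<Gamma>. w t \<ge> 0" "w (i, x, y) > 0"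
    "\<forall>c\<in>profiles \<Gamma>. (\<Sum>t\<in>switches \<Gamma>. switch_gain \<Gamma> c t * w t) \<ge> 0"
    by (elim exE conjE) (rule that)
  have ineq: "(\<Sum>i\<in>players \<Gamma>. \<Sum>d\<in>strategies \<Gamma> i.
        w (i, c i, d) * (utility \<Gamma> i (c(i := d)) - utility \<Gamma> i c)) \<ge> 0" if c: "c \<in> profiles \<Gamma>" for c
  proof -
    have "(\<Sum>t\<in>switches \<Gamma>. switch_gain \<Gamma> c t * w t) =
       (\<Sum>i\<in>players \<Gamma>. \<Sum>x\<in>strategies \<Gamma> i. \<Sum>y\<in>strategies \<Gamma> i. switch_gain \<Gamma> c (i, x, y) * w (i, x, y))"
      unfolding switches_def using finite_gameD[OF \<Gamma>]
      by (simp add: sum.Sigma sum.cartesian_product split_def)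
    also have "\<dots> = (\<Sum>i\<in>players \<Gamma>. \<Sum>d\<in>strategies \<Gamma> i. w (i, c i, d) * (utility \<Gamma> i (c(i := d)) - utility \<Gamma> i c))"
    proof (rule sum.cong[OF refl])
      fix i assume i: "i \<in> players \<Gamma>"
      then have ci: "c i \<in> strategies \<Gamma> i" using c by (auto simp: profiles_def)
      have "(\<Sum>x\<in>strategies \<Gamma> i. \<Sum>y\<in>strategies \<Gamma> i. switch_gain \<Gamma> c (i, x, y) * w (i, x, y)) =
        (\<Sum>x\<in>strategies \<Gamma> i. if x = c i then
          (\<Sum>d\<in>strategies \<Gamma> i. w (i, c i, d) * (utility \<Gamma> i (c(i := d)) - utility \<Gamma> i c)) else 0)"
        by (intro sum.cong refl) (auto simp: switch_gain_def mult.commute)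
      then show "(\<Sum>x\<in>strategies \<Gamma> i. \<Sum>y\<in>strategies \<Gamma> i. switch_gain \<Gamma> c (i, x, y) * w (i, x, y)) =
        (\<Sum>d\<in>strategies \<Gamma> i. w (i, c i, d) * (utility \<Gamma> i (c(i := d)) - utility \<Gamma> i c))"
        using ci finite_gameD(3)[OF \<Gamma> i] by simp
    qed
    finally show ?thesis using bspec[OF w(3) c] by simp
  qed
  obtain \<alpha> where "dual_vector \<Gamma> \<alpha>"
    "\<And>i x y. (i, x, y) \<in> switches \<Gamma> \<Longrightarrow> w (i, x, y) > 0 \<or> y = x \<Longrightarrow> pmf (\<alpha> i x) y > 0"
    using dual_vector_of_weights[of \<Gamma> "\<lambda>i x y. w (i, x, y)", OF \<Gamma> bspec[OF w(1)] ineq] by blast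
  then have "\<exists>\<alpha>. dual_vector \<Gamma> \<alpha> \<and> pmf (\<alpha> i x) y > 0"
    using t0 w(2) by blast
  then show ?thesis by (rule disjI2)
qed (rule disjI1)

lemma small_perturbation:
  fixes a b :: "'t \<Rightarrow> real"
  assumes "finite T" "\<And>t. t \<in> T \<Longrightarrow> a t < 0"
  obtains e where "e > 0" "\<And>t. t \<in> T \<Longrightarrow> a t + e * b t < 0"
proof -
  have "\<forall>t\<in>T. \<forall>\<^sub>F e in at_right 0. a t + e * b t < 0"
  proof
    fix t assume "t \<in> T"
    have "((\<lambda>e. a t + e * b t) \<longlongrightarrow> a t + 0 * b t) (at_right 0)"
      by (intro tendsto_intros)
    then show "\<forall>\<^sub>F e in at_right 0. a t + e * b t < 0"
      using assms(2)[OF \<open>t \<in> T\<close>] by (intro order_tendstoD(2)) auto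
  qed
  then have "\<forall>\<^sub>F e in at_right 0. \<forall>t\<in>T. a t + e * b t < 0"
    using assms(1) by (simp add: eventually_ball_finite)
  then have "\<forall>\<^sub>F e in at_right (0::real). e > 0 \<and> (\<forall>t\<in>T. a t + e * b t < 0)"
    using eventually_at_right_less by (rule eventually_conj[rotated])
  from eventually_happens'[OF trivial_limit_at_right_real this]
  show ?thesis by (elim exE conjE) (rule that, assumption, erule (1) bspec)
qed

text \<open>
  If no dual vector moves any strategy, complementarity makes each off-diagonal incentive constraint
  slack in some equilibrium; then all are slack for the sum of these equilibria, and remain so after a small constant is
  added to give all profiles positive weight.
\<close>

lemma elementary_or_nontrivial_dual_vector:
  assumes \<Gamma>: "finite_game \<Gamma>"
  shows "elementary \<Gamma> \<or>
    (\<exists>\<alpha> i x y. dual_vector \<Gamma> \<alpha> \<and> (i, x, y) \<in> switches \<Gamma> \<and> y \<noteq> x \<and> pmf (\<alpha> i x) y > 0)"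
proof (rule disjCI)
  let ?P = "profiles \<Gamma>"
  define T where "T = switches \<Gamma> - {(i, x, y). y = x}"
  have T: "finite T" "T \<subseteq> switches \<Gamma>" using finite_switches[OF \<Gamma>] by (auto simp: T_def)
  assume none: "\<not> (\<exists>\<alpha> i x y. dual_vector \<Gamma> \<alpha> \<and> (i, x, y) \<in> switches \<Gamma> \<and> y \<noteq> x \<and> pmf (\<alpha> i x) y > 0)"
  have "\<exists>v. (\<forall>c\<in>?P. v c \<ge> 0) \<and> (\<forall>s\<in>switches \<Gamma>. (\<Sum>c\<in>?P. v c * switch_gain \<Gamma> c s) \<le> 0) \<and>
      (\<Sum>c\<in>?P. v c * switch_gain \<Gamma> c t) < 0" if "t \<in> T" for t
  proof -
    obtain i x y where t: "t = (i, x, y)" by (cases t)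
    with that have t: "t = (i, x, y)" "(i, x, y) \<in> switches \<Gamma>" "y \<noteq> x"
      by (simp_all add: T_def)
    then have "\<not> (\<exists>\<alpha>. dual_vector \<Gamma> \<alpha> \<and> pmf (\<alpha> i x) y > 0)" using none by blast
    then show ?thesis
      using switch_complementarity[OF \<Gamma> t(2)] unfolding t(1) by (elim disjE) (assumption, erule (1) notE)
  qed
  then have "\<exists>v. \<forall>t\<in>T. (\<forall>c\<in>?P. v t c \<ge> 0) \<and>
     (\<forall>s\<in>switches \<Gamma>. (\<Sum>c\<in>?P. v t c * switch_gain \<Gamma> c s) \<le> 0) \<and> (\<Sum>c\<in>?P. v t c * switch_gain \<Gamma> c t) < 0"
    by (intro bchoice ballI)
  then obtain v where "\<forall>t\<in>T. (\<forall>c\<in>?P. v t c \<ge> 0) \<and>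
     (\<forall>s\<in>switches \<Gamma>. (\<Sum>c\<in>?P. v t c * switch_gain \<Gamma> c s) \<le> 0) \<and> (\<Sum>c\<in>?P. v t c * switch_gain \<Gamma> c t) < 0"
    by (elim exE) (rule that)
  then have v: "\<And>t c. t \<in> T \<Longrightarrow> c \<in> ?P \<Longrightarrow> v t c \<ge> 0"
    "\<And>t s. t \<in> T \<Longrightarrow> s \<in> switches \<Gamma> \<Longrightarrow> (\<Sum>c\<in>?P. v t c * switch_gain \<Gamma> c s) \<le> 0"
    "\<And>t. t \<in> T \<Longrightarrow> (\<Sum>c\<in>?P. v t c * switch_gain \<Gamma> c t) < 0"
    by blast+
  define V where "V c = (\<Sum>t\<in>T. v t c)" for c
  have V_nonneg: "V c \<ge> 0" if "c \<in> ?P" for c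
    unfolding V_def using v(1) that by (intro sum_nonneg)
  have V_gain: "(\<Sum>c\<in>?P. V c * switch_gain \<Gamma> c t) < 0" if t: "t \<in> T" for t
  proof -
    have "(\<Sum>c\<in>?P. V c * switch_gain \<Gamma> c t) = (\<Sum>s\<in>T. \<Sum>c\<in>?P. v s c * switch_gain \<Gamma> c t)"
      unfolding V_def sum_distrib_right by (rule sum.swap)
    also have "\<dots> = (\<Sum>c\<in>?P. v t c * switch_gain \<Gamma> c t) + (\<Sum>s\<in>T - {t}. \<Sum>c\<in>?P. v s c * switch_gain \<Gamma> c t)"
      using T(1) t by (rule sum.remove)
    also have "\<dots> < 0"
    proof (rule add_neg_nonpos[OF v(3)[OF t] sum_nonpos])
      fix s assume "s \<in> T - {t}"
      then show "(\<Sum>c\<in>?P. v s c * switch_gain \<Gamma> c t) \<le> 0"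
        using v(2)[of s t] t T(2) by blast
    qed
    finally show ?thesis .
  qed
  obtain e where e: "e > 0" "\<And>t. t \<in> T \<Longrightarrow>
      (\<Sum>c\<in>?P. V c * switch_gain \<Gamma> c t) + e * (\<Sum>c\<in>?P. switch_gain \<Gamma> c t) < 0"
    using small_perturbation[OF T(1), of "\<lambda>t. \<Sum>c\<in>?P. V c * switch_gain \<Gamma> c t"
        "\<lambda>t. \<Sum>c\<in>?P. switch_gain \<Gamma> c t"] V_gain by blast
  have gain: "(\<Sum>c\<in>?P. (V c + e) * switch_gain \<Gamma> c t) < 0" if "t \<in> T" for t
    using e(2)[OF that] by (simp add: ring_distribs sum.distrib sum_distrib_left)
  have diag: "(\<Sum>c\<in>?P. u c * switch_gain \<Gamma> c t) = 0" if "t \<in> switches \<Gamma> - T" for t and u :: "('a \<Rightarrow> 'b) \<Rightarrow> real"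
    using that by (auto simp: T_def switch_gain_refl)
  have pos: "V c + e > 0" if "c \<in> ?P" for c using V_nonneg[OF that] e(1) by simp
  have total: "(\<Sum>c\<in>?P. V c + e) > 0"
    using pos finite_gameD(5,7)[OF \<Gamma>] by (intro sum_pos)
  obtain \<mu> where \<mu>: "correlated_equilibrium \<Gamma> \<mu>" "\<And>c. c \<in> ?P \<Longrightarrow> pmf \<mu> c = (V c + e) / (\<Sum>c\<in>?P. V c + e)"
  proof (rule correlated_equilibrium_of_weights[OF \<Gamma>, of "\<lambda>c. V c + e"])
    show "V c + e \<ge> 0" if "c \<in> ?P" for c using pos[OF that] by simp
    show "(\<Sum>c\<in>?P. (V c + e) * switch_gain \<Gamma> c t) \<le> 0" if "t \<in> switches \<Gamma>" for t
      using gain[of t] diag[of t "\<lambda>c. V c + e"] that by (cases "t \<in> T") auto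
  qed (use total in simp_all)
  have "deviation_gain \<Gamma> \<mu> i x y < 0" if "i \<in> players \<Gamma>" "x \<in> strategies \<Gamma> i" "y \<in> strategies \<Gamma> i" "y \<noteq> x" for i x y
  proof -
    have sw: "(i, x, y) \<in> switches \<Gamma>" and t: "(i, x, y) \<in> T" using that by (auto simp: T_def switches_iff)
    have "deviation_gain \<Gamma> \<mu> i x y = (\<Sum>c\<in>?P. (V c + e) * switch_gain \<Gamma> c (i, x, y)) / (\<Sum>c\<in>?P. V c + e)"
      unfolding deviation_gain_eq[OF \<Gamma> sw] sum_divide_distrib by (intro sum.cong) (simp_all add: \<mu>(2))
    then show ?thesis using gain[OF t] total by (simp add: divide_neg_pos)
  qed
  moreover have "pmf \<mu> c > 0" if "c \<in> ?P" for c using \<mu>(2)[OF that] pos[OF that] total by simp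
  ultimately show "elementary \<Gamma>"
    using \<mu>(1) by (auto simp: elementary_def strict_correlated_equilibrium_def)
qed

text \<open>
  The distribution \<open>\<nu>'\<close> puts additional weight on \<open>c\<close>; strictness leaves room for it
  in every incentive constraint.
\<close>

lemma elementary_perturbation:
  assumes G: "finite_game G" and el: "elementary G"
  obtains \<nu> where "correlated_equilibrium G \<nu>"
    and "\<And>c. c \<in> profiles G \<Longrightarrow> \<exists>e>0. \<exists>\<nu>'. correlated_equilibrium G \<nu>' \<and>
       (\<forall>s\<in>profiles G. pmf \<nu>' s = (pmf \<nu> s + (if s = c then e else 0)) / (1 + e))"
proof -
  let ?P = "profiles G"
  obtain \<nu> where \<nu>: "strict_correlated_equilibrium G \<nu>" "\<And>c. c \<in> ?P \<Longrightarrow> pmf \<nu> c > 0"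
    using el by (auto simp: elementary_def)
  have ce: "correlated_equilibrium G \<nu>" using \<nu>(1) by (simp add: strict_correlated_equilibrium_def)
  have fin: "finite ?P" using finite_gameD(5)[OF G] .
  define T where "T = switches G - {(i, x, y). y = x}"
  have T: "finite T" using finite_switches[OF G] by (simp add: T_def)
  have strict: "(\<Sum>c\<in>?P. pmf \<nu> c * switch_gain G c t) < 0" if t: "t \<in> T" for t
  proof -
    obtain i x y where eq: "t = (i, x, y)" by (cases t)
    with t have t: "t = (i, x, y)" and sw: "(i, x, y) \<in> switches G" and ne: "y \<noteq> x"
      by (simp_all add: T_def)
    then have i: "i \<in> players G" "x \<in> strategies G i" "y \<in> strategies G i" by (auto simp: switches_iff)
    obtain c where "c \<in> ?P" using finite_gameD(7)[OF G] by blast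
    then have "c(i := x) \<in> ?P" using i by (intro profile_upd)
    then have "c(i := x) \<in> set_pmf \<nu>" using \<nu>(2) by (simp add: set_pmf_iff less_le)
    then have "x \<in> set_pmf (map_pmf (\<lambda>c. c i) \<nu>)" by (auto intro!: image_eqI[where x = "c(i := x)"])
    then have "pmf (map_pmf (\<lambda>c. c i) \<nu>) x > 0" by (rule pmf_positive)
    then have "deviation_gain G \<nu> i x y < 0"
      using \<nu>(1) i ne by (simp add: strict_correlated_equilibrium_def)
    then show ?thesis using deviation_gain_eq[OF G sw] t by simp
  qed
  have "\<exists>e>0. \<exists>\<nu>'. correlated_equilibrium G \<nu>' \<and>
       (\<forall>s\<in>?P. pmf \<nu>' s = (pmf \<nu> s + (if s = c then e else 0)) / (1 + e))" if c: "c \<in> ?P" for c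
  proof -
    obtain e where e: "e > 0" "\<And>t. t \<in> T \<Longrightarrow> (\<Sum>s\<in>?P. pmf \<nu> s * switch_gain G s t) + e * switch_gain G c t < 0"
      using small_perturbation[OF T, of "\<lambda>t. \<Sum>s\<in>?P. pmf \<nu> s * switch_gain G s t"
          "switch_gain G c"] strict by blast
    let ?v = "\<lambda>s. pmf \<nu> s + (if s = c then e else 0)"
    have sum_v: "(\<Sum>s\<in>?P. ?v s) = 1 + e"
      using ce c fin by (simp add: sum.distrib sum_pmf_eq_1_superset correlated_equilibrium_def)
    have "(\<Sum>s\<in>?P. ?v s * switch_gain G s t) \<le> 0" if "t \<in> switches G" for t
    proof (cases "t \<in> T")
      case True
      have "(\<Sum>s\<in>?P. ?v s * switch_gain G s t) =
         (\<Sum>s\<in>?P. pmf \<nu> s * switch_gain G s t + (if s = c then e * switch_gain G s t else 0))"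
        by (intro sum.cong) (auto simp: ring_distribs)
      also have "\<dots> = (\<Sum>s\<in>?P. pmf \<nu> s * switch_gain G s t) + e * switch_gain G c t"
        using c fin by (simp add: sum.distrib)
      finally show ?thesis using e(2)[OF True] by simp
    next
      case False
      then show ?thesis using that by (auto simp: T_def switch_gain_refl)
    qed
    moreover have "?v s \<ge> 0" for s using e(1) by simp
    moreover have "(\<Sum>s\<in>?P. ?v s) > 0" using e(1) sum_v by simp
    ultimately obtain \<nu>' where "correlated_equilibrium G \<nu>'"
      and "\<And>s. s \<in> ?P \<Longrightarrow> pmf \<nu>' s = ?v s / (\<Sum>s\<in>?P. ?v s)"
      using correlated_equilibrium_of_weights[OF G, of ?v] by blast
    then have "correlated_equilibrium G \<nu>' \<and> (\<forall>s\<in>?P. pmf \<nu>' s = ?v s / (1 + e))"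
      by (simp only: sum_v) simp
    with e(1) show ?thesis by blast
  qed
  with ce show ?thesis by (rule that)
qed

section \<open>Iterated reductions\<close>

lemma compose_mixtures_simps [simp]:
  "players (compose_mixtures \<Gamma> H) = players H"
  "utility (compose_mixtures \<Gamma> H) = mixed_utility \<Gamma>"
  "i \<in> players H \<Longrightarrow> strategies (compose_mixtures \<Gamma> H) i = join_pmf ` strategies H i"
  by (simp_all add: compose_mixtures_def)

lemma mixed_utility_cong:
  assumes "\<And>j. j \<in> players \<Gamma> \<Longrightarrow> s j = t j"
  shows "mixed_utility \<Gamma> i s = mixed_utility \<Gamma> i t"
  using product_distribution_cong[of \<Gamma> s t] assms by (simp add: mixed_utility_def)

lemma finite_game_compose_mixtures:
  "finite_game H \<Longrightarrow> finite_game (compose_mixtures \<Gamma> H)"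
  by (simp add: finite_game_def)

lemma iterative_dual_reduction_game:
  assumes "iterative_dual_reduction \<Gamma> G" "finite_game \<Gamma>"
  shows "finite_game G \<and> (\<forall>i\<in>players \<Gamma>. \<forall>s\<in>strategies G i. set_pmf s \<subseteq> strategies \<Gamma> i)"
  using assms
proof (induction rule: iterative_dual_reduction.induct)
  case (single \<alpha>)
  then show ?case using finite_game_reduced reduced_strategies_support by fastforce
next
  case (step G \<alpha>)
  have players: "players G = players \<Gamma>" using step.hyps(1) by (rule iterative_dual_reduction_players)
  have G: "finite_game G" and sub: "\<And>i s. i \<in> players \<Gamma> \<Longrightarrow> s \<in> strategies G i \<Longrightarrow> set_pmf s \<subseteq> strategies \<Gamma> i"
    using step.IH step.prems by auto
  show ?case
  proof (intro conjI ballI)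
    show "finite_game (compose_mixtures \<Gamma> (reduced_game G \<alpha>))"
      using G step.hyps(2) by (intro finite_game_compose_mixtures finite_game_reduced)
    fix i s assume i: "i \<in> players \<Gamma>" and "s \<in> strategies (compose_mixtures \<Gamma> (reduced_game G \<alpha>)) i"
    then obtain p where p: "p \<in> reduced_strategies (strategies G i) (\<alpha> i)" "s = join_pmf p"
      by (auto simp: players)
    have "set_pmf s = (\<Union>q\<in>set_pmf p. set_pmf q)" by (simp add: p(2) join_eq_bind_pmf)
    then show "set_pmf s \<subseteq> strategies \<Gamma> i"
      using sub[OF i] reduced_strategies_support[OF p(1)] by blast
  qed
qed

lemma product_distribution_join:
  assumes "finite (players \<Gamma>)" "players G = players \<Gamma>"
  shows "bind_pmf (product_distribution G s) (product_distribution \<Gamma>) =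
    product_distribution \<Gamma> (\<lambda>j. join_pmf (s j))"
  using Pi_pmf_bind[OF assms(1), of undefined s "\<lambda>_. id" undefined]
  by (simp add: product_distribution_def[abs_def] join_eq_bind_pmf assms(2))

lemma sum_pmf_expectation:
  assumes "finite P" "set_pmf p \<subseteq> P"
  shows "(\<Sum>c\<in>P. pmf p c * g c) = measure_pmf.expectation p g"
  using integral_measure_pmf_real[of P p g] assms by (simp add: mult.commute subset_iff)

text \<open>
  Composing mixtures might identify strategies of the reduced game.  Choosing one preimage for each
  composed strategy nevertheless lifts equilibria: payoffs depend only on the composed strategies, and
  strategies that were not chosen are never recommended.
\<close>

lemma composed_equilibrium_lift:
  assumes \<Gamma>: "finite_game \<Gamma>" and it: "iterative_dual_reduction \<Gamma> G" and \<alpha>: "dual_vector G \<alpha>"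
    and \<nu>: "correlated_equilibrium (compose_mixtures \<Gamma> (reduced_game G \<alpha>)) \<nu>"
  obtains \<nu>' where "correlated_equilibrium (reduced_game G \<alpha>) \<nu>'"
    and "map_pmf (\<lambda>c. \<lambda>i\<in>players \<Gamma>. join_pmf (c i)) \<nu>' = \<nu>"
proof -
  let ?K = "reduced_game G \<alpha>"
  let ?H = "compose_mixtures \<Gamma> ?K"
  have players: "players G = players \<Gamma>" using it by (rule iterative_dual_reduction_players)
  have G: "finite_game G" and sub: "\<And>i s. i \<in> players \<Gamma> \<Longrightarrow> s \<in> strategies G i \<Longrightarrow> set_pmf s \<subseteq> strategies \<Gamma> i"
    using iterative_dual_reduction_game[OF it \<Gamma>] by auto
  have K: "finite_game ?K" using G \<alpha> by (rule finite_game_reduced)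
  have H: "finite_game ?H" using K by (rule finite_game_compose_mixtures)
  define e where "e i = inv_into (strategies ?K i) join_pmf" for i
  define lift where "lift c = (\<lambda>i\<in>players \<Gamma>. e i (c i))" for c
  have \<nu>_supp: "set_pmf \<nu> \<subseteq> profiles ?H" using \<nu> by (simp add: correlated_equilibrium_def)
  have e_mem: "e i q \<in> strategies ?K i" and join_e: "join_pmf (e i q) = q"
    if "i \<in> players \<Gamma>" "q \<in> strategies ?H i" for i q
  proof -
    have "q \<in> join_pmf ` strategies ?K i" using that by (simp add: players)
    then show "e i q \<in> strategies ?K i" "join_pmf (e i q) = q"
      unfolding e_def by (rule inv_into_into, rule f_inv_into_f)
  qed
  have H_mem: "c i \<in> strategies ?H i" if "c \<in> profiles ?H" "i \<in> players \<Gamma>" for c i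
    using PiE_mem[OF that(1)[unfolded profiles_def], of i] that(2) by (simp add: players)
  have lift: "lift c \<in> profiles ?K" if "c \<in> profiles ?H" for c
    unfolding profiles_def using e_mem H_mem[OF that] by (simp add: lift_def players)
  have K_payoff: "mixed_utility G i s = mixed_utility \<Gamma> i (\<lambda>j. join_pmf (s j))" if s: "s \<in> profiles ?K" for s i
  proof (rule mixed_utility_join[OF it finite_gameD(1)[OF \<Gamma>], symmetric])
    fix j assume j: "j \<in> players \<Gamma>"
    have supp: "set_pmf (s j) \<subseteq> strategies G j" using reduced_profile_mixed(1)[OF s] j players by simp
    then show "finite (set_pmf (s j))" using finite_gameD(3)[OF G] j players by (simp add: finite_subset)
    show "finite (set_pmf q)" if "q \<in> set_pmf (s j)" for q
    proof -
      have "set_pmf q \<subseteq> strategies \<Gamma> j" using supp that sub[OF j] by blast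
      then show ?thesis using finite_gameD(3)[OF \<Gamma> j] by (simp add: finite_subset)
    qed
  qed
  have gain: "switch_gain ?K (lift c) (i, x, y) =
      (if e i (join_pmf x) = x then switch_gain ?H c (i, join_pmf x, join_pmf y) else 0)"
    if c: "c \<in> profiles ?H" and sw: "(i, x, y) \<in> switches ?K" for c i x y
  proof -
    have i: "i \<in> players \<Gamma>" and y: "y \<in> strategies ?K i"
      using sw[unfolded switches_iff] by (metis players reduced_game_simps(1))+
    have i': "i \<in> players ?K" using i by (simp add: players)
    have lift_i: "lift c i = e i (c i)" and join_i: "join_pmf (lift c i) = c i"
      using i join_e[OF i H_mem[OF c i]] by (simp_all add: lift_def)
    show ?thesis
    proof (cases "lift c i = x")
      case True
      then have x: "e i (join_pmf x) = x" "c i = join_pmf x" using lift_i join_i by auto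
      have "mixed_utility G i ((lift c)(i := y)) = mixed_utility \<Gamma> i (c(i := join_pmf y))"
        unfolding K_payoff[OF profile_upd[OF lift[OF c] i' y]]
        by (rule mixed_utility_cong) (auto simp: lift_def join_e H_mem[OF c])
      moreover have "mixed_utility G i (lift c) = mixed_utility \<Gamma> i c"
        unfolding K_payoff[OF lift[OF c]]
        by (rule mixed_utility_cong) (auto simp: lift_def join_e H_mem[OF c])
      ultimately show ?thesis using True x by (simp add: switch_gain_def)
    next
      case False
      then have "c i \<noteq> join_pmf x" if "e i (join_pmf x) = x" using that lift_i by auto
      then show ?thesis using False by (simp add: switch_gain_def)
    qed
  qed
  define \<nu>' where "\<nu>' = map_pmf lift \<nu>"
  have \<nu>'_supp: "set_pmf \<nu>' \<subseteq> profiles ?K"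
    unfolding \<nu>'_def using lift \<nu>_supp by auto
  have "(\<Sum>s\<in>profiles ?K. pmf \<nu>' s * switch_gain ?K s t) \<le> 0" if t: "t \<in> switches ?K" for t
  proof -
    obtain i x y where eq: "t = (i, x, y)" by (cases t)
    have sw: "(i, x, y) \<in> switches ?K" using t eq by simp
    have sw': "(i, join_pmf x, join_pmf y) \<in> switches ?H" using sw by (auto simp: switches_iff)
    have "(\<Sum>s\<in>profiles ?K. pmf \<nu>' s * switch_gain ?K s t) = (\<Sum>c\<in>profiles ?H. pmf \<nu> c * switch_gain ?K (lift c) t)"
      unfolding sum_pmf_expectation[OF finite_gameD(5)[OF K] \<nu>'_supp]
        sum_pmf_expectation[OF finite_gameD(5)[OF H] \<nu>_supp] by (simp add: \<nu>'_def)
    also have "\<dots> = (\<Sum>c\<in>profiles ?H. pmf \<nu> c *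
        (if e i (join_pmf x) = x then switch_gain ?H c (i, join_pmf x, join_pmf y) else 0))"
      unfolding eq by (intro sum.cong refl arg_cong2[where f = "(*)"] gain sw)
    also have "\<dots> \<le> 0"
    proof (cases "e i (join_pmf x) = x")
      case True
      then show ?thesis
        using \<nu> sw' correlated_equilibrium_iff[OF H, of \<nu>] by simp
    qed simp
    finally show ?thesis .
  qed
  then have "correlated_equilibrium ?K \<nu>'"
    using \<nu>'_supp by (simp add: correlated_equilibrium_iff[OF K])
  moreover have "map_pmf (\<lambda>c. \<lambda>i\<in>players \<Gamma>. join_pmf (c i)) \<nu>' = \<nu>"
  proof -
    have "(\<lambda>i\<in>players \<Gamma>. join_pmf (lift c i)) = c" if "c \<in> set_pmf \<nu>" for c
    proof -
      have c: "c \<in> profiles ?H" using that \<nu>_supp by blast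
      then have "c \<in> extensional (players \<Gamma>)" by (simp add: profiles_def PiE_def players)
      then show ?thesis
        by (intro extensionalityI[of _ "players \<Gamma>"]) (simp_all add: lift_def join_e H_mem[OF c])
    qed
    then have "map_pmf (\<lambda>c. \<lambda>i\<in>players \<Gamma>. join_pmf (lift c i)) \<nu> = map_pmf (\<lambda>c. c) \<nu>"
      by (intro map_pmf_cong refl)
    then show ?thesis by (simp add: \<nu>'_def map_pmf_comp)
  qed
  ultimately show ?thesis by (rule that)
qed

lemma iterated_equilibrium_induces_equilibrium:
  assumes "iterative_dual_reduction \<Gamma> G" "finite_game \<Gamma>" "correlated_equilibrium G \<nu>"
  shows "correlated_equilibrium \<Gamma> (bind_pmf \<nu> (product_distribution \<Gamma>))"
  using assms
proof (induction arbitrary: \<nu> rule: iterative_dual_reduction.induct)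
  case (single \<alpha>)
  then show ?case by (intro reduced_equilibrium_induces_equilibrium)
next
  case (step G \<alpha>)
  have players: "players G = players \<Gamma>" using step.hyps(1) by (rule iterative_dual_reduction_players)
  have G: "finite_game G" using iterative_dual_reduction_game[OF step.hyps(1) step.prems(1)] by simp
  obtain \<nu>' where \<nu>': "correlated_equilibrium (reduced_game G \<alpha>) \<nu>'"
    "map_pmf (\<lambda>c. \<lambda>i\<in>players \<Gamma>. join_pmf (c i)) \<nu>' = \<nu>"
    using composed_equilibrium_lift[OF step.prems(1) step.hyps step.prems(2)] by blast
  have "bind_pmf (product_distribution G s) (product_distribution \<Gamma>) =
      product_distribution \<Gamma> (\<lambda>i\<in>players \<Gamma>. join_pmf (s i))" for s
    unfolding product_distribution_join[OF finite_gameD(1)[OF step.prems(1)] players]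
    by (rule product_distribution_cong) simp
  then have "bind_pmf (bind_pmf \<nu>' (product_distribution G)) (product_distribution \<Gamma>) =
      bind_pmf \<nu> (product_distribution \<Gamma>)"
    by (simp add: \<nu>'(2)[symmetric] bind_map_pmf bind_assoc_pmf)
  then show ?case
    using step.IH[OF step.prems(1) reduced_equilibrium_induces_equilibrium[OF G step.hyps(2) \<nu>'(1)]] by simp
qed

text \<open>
  An iterated reduction with the fewest pure strategies is elementary, since a nontrivial dual vector
  would reduce it further.
\<close>

lemma elementary_iterate_exists:
  assumes \<Gamma>: "finite_game \<Gamma>"
  obtains G where "iterative_dual_reduction \<Gamma> G" "elementary G"
proof -
  let ?size = "\<lambda>G. \<Sum>i\<in>players \<Gamma>. card (strategies G i)"
  obtain \<alpha> where "dual_vector \<Gamma> \<alpha>" using dual_vector_exists[OF \<Gamma>] .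
  then have "iterative_dual_reduction \<Gamma> (reduced_game \<Gamma> \<alpha>)" by (rule iterative_dual_reduction.single)
  from ex_has_least_nat[of "iterative_dual_reduction \<Gamma>", OF this, of ?size]
  obtain G where it: "iterative_dual_reduction \<Gamma> G"
    and min: "\<And>H. iterative_dual_reduction \<Gamma> H \<Longrightarrow> ?size G \<le> ?size H" by blast
  have G: "finite_game G" using iterative_dual_reduction_game[OF it \<Gamma>] by simp
  have players: "players G = players \<Gamma>" using it by (rule iterative_dual_reduction_players)
  have "elementary G"
  proof (rule ccontr)
    assume "\<not> elementary G"
    then obtain \<beta> i x y where \<beta>: "dual_vector G \<beta>" and sw: "(i, x, y) \<in> switches G" "y \<noteq> x" "pmf (\<beta> i x) y > 0"
      using elementary_or_nontrivial_dual_vector[OF G] by blast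
    let ?H = "compose_mixtures \<Gamma> (reduced_game G \<beta>)"
    have i: "i \<in> players \<Gamma>" and x: "x \<in> strategies G i" using sw(1) by (auto simp: switches_iff players)
    have card: "card (strategies ?H j) \<le> card (reduced_strategies (strategies G j) (\<beta> j))" if "j \<in> players \<Gamma>" for j
      using that finite_gameD(3)[OF G, of j] by (simp add: players card_image_le finite_reduced_strategies)
    have "?size ?H < ?size G"
    proof (rule sum_strict_mono_ex1[OF finite_gameD(1)[OF \<Gamma>]], intro ballI)
      fix j assume j: "j \<in> players \<Gamma>"
      show "card (strategies ?H j) \<le> card (strategies G j)"
        using card[OF j] card_reduced_strategies_le[of "strategies G j" "\<beta> j"] finite_gameD(3)[OF G, of j] j
        by (simp add: players)
    next
      have "card (strategies ?H i) < card (strategies G i)"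
        using card[OF i] card_reduced_strategies_less[of "strategies G i" x y "\<beta> i"] finite_gameD(3)[OF G, of i] i x sw
        by (simp add: players)
      with i show "\<exists>j\<in>players \<Gamma>. card (strategies ?H j) < card (strategies G j)" ..
    qed
    moreover have "iterative_dual_reduction \<Gamma> ?H" using it \<beta> by (rule iterative_dual_reduction.step)
    ultimately show False using min[of ?H] by simp
  qed
  then show ?thesis using it that by blast
qed

section \<open>Games with a unique correlated equilibrium\<close>

text \<open>
  Both \<open>\<nu>\<close> and its perturbation towards \<open>c\<close> induce \<open>\<mu>\<close>.  Comparing the two
  mixtures isolates the contribution of \<open>c\<close>.
\<close>

lemma elementary_iterate_profile:
  assumes \<Gamma>: "finite_game \<Gamma>" and unique: "\<And>\<nu>. correlated_equilibrium \<Gamma> \<nu> \<Longrightarrow> \<nu> = \<mu>"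
    and it: "iterative_dual_reduction \<Gamma> G" and el: "elementary G" and c: "c \<in> profiles G"
  shows "product_distribution \<Gamma> c = \<mu>"
proof (rule pmf_eqI)
  fix z
  let ?P = "profiles G"
  let ?p = "\<lambda>s. pmf (product_distribution \<Gamma> s) z"
  have G: "finite_game G" using iterative_dual_reduction_game[OF it \<Gamma>] by simp
  have fin: "finite ?P" using finite_gameD(5)[OF G] .
  have push: "(\<Sum>s\<in>?P. pmf \<nu> s * ?p s) = pmf \<mu> z" if "correlated_equilibrium G \<nu>" for \<nu>
  proof -
    have "bind_pmf \<nu> (product_distribution \<Gamma>) = \<mu>"
      using unique iterated_equilibrium_induces_equilibrium[OF it \<Gamma> that] by blast
    then show ?thesis
      using pmf_bind_finite[OF fin, of \<nu> "product_distribution \<Gamma>" z] that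
      by (simp add: correlated_equilibrium_def)
  qed
  obtain \<nu> where \<nu>: "correlated_equilibrium G \<nu>" and "\<exists>e>0. \<exists>\<nu>'. correlated_equilibrium G \<nu>' \<and>
       (\<forall>s\<in>?P. pmf \<nu>' s = (pmf \<nu> s + (if s = c then e else 0)) / (1 + e))"
    using elementary_perturbation[OF G el] c by metis
  then obtain e \<nu>' where e: "e > 0" and \<nu>': "correlated_equilibrium G \<nu>'"
     "\<And>s. s \<in> ?P \<Longrightarrow> pmf \<nu>' s = (pmf \<nu> s + (if s = c then e else 0)) / (1 + e)"
    by blast
  have "(1 + e) * pmf \<mu> z = (1 + e) * (\<Sum>s\<in>?P. pmf \<nu>' s * ?p s)"
    using push[OF \<nu>'(1)] by simp
  also have "\<dots> = (\<Sum>s\<in>?P. pmf \<nu> s * ?p s + (if s = c then e * ?p s else 0))"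
    unfolding sum_distrib_left using e by (intro sum.cong) (auto simp: \<nu>'(2) field_simps)
  also have "\<dots> = pmf \<mu> z + e * ?p c"
    using push[OF \<nu>] c fin by (simp add: sum.distrib)
  finally show "?p c = pmf \<mu> z" using e by (simp add: ring_distribs)
qed

lemma product_distribution_inj:
  assumes "finite_game \<Gamma>" "product_distribution \<Gamma> s = product_distribution \<Gamma> t"
    and "s \<in> extensional (players \<Gamma>)" "t \<in> extensional (players \<Gamma>)"
  shows "s = t"
proof (rule extensionalityI[OF assms(3,4)])
  fix j assume "j \<in> players \<Gamma>"
  then show "s j = t j"
    using product_distribution_component[OF assms(1), of j] assms(2) by metis
qed

text \<open>
  The incentive constraint of such a pair holds with equality in the only correlated equilibrium:
  trivially if \<open>x\<close> is never played, and because both strategies are best replies if they are both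
  in the support.  So complementarity leaves only the dual vector.
\<close>

lemma full_dual_vector_positive:
  assumes \<Gamma>: "finite_game \<Gamma>" and ce: "correlated_equilibrium \<Gamma> (product_distribution \<Gamma> \<sigma>)"
    and unique: "\<And>\<nu>. correlated_equilibrium \<Gamma> \<nu> \<Longrightarrow> \<nu> = product_distribution \<Gamma> \<sigma>"
    and full: "full_dual_vector \<Gamma> \<alpha>" and sw: "(i, x, y) \<in> switches \<Gamma>"
    and xy: "x \<in> set_pmf (\<sigma> i) \<Longrightarrow> y \<in> set_pmf (\<sigma> i)"
  shows "pmf (\<alpha> i x) y > 0"
proof -
  let ?P = "profiles \<Gamma>"
  let ?f = "payoff_against \<Gamma> \<sigma> i"
  have le: "pmf (\<sigma> i) a * (?f b - ?f a) \<le> 0" if "(i, a, b) \<in> switches \<Gamma>" for a b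
    using ce that deviation_gain_product[OF \<Gamma> that, of \<sigma>, symmetric]
    by (simp add: correlated_equilibrium_def switches_iff)
  have tight: "deviation_gain \<Gamma> (product_distribution \<Gamma> \<sigma>) i x y = 0"
  proof (cases "x \<in> set_pmf (\<sigma> i)")
    case True
    have "pmf (\<sigma> i) x > 0" "pmf (\<sigma> i) y > 0" using True xy by (simp_all add: pmf_positive_iff)
    moreover have "(i, y, x) \<in> switches \<Gamma>" using sw by (simp add: switches_iff)
    ultimately have "?f x = ?f y" using le[OF sw] le[of y x] by (simp add: mult_le_0_iff)
    then show ?thesis by (simp add: deviation_gain_product[OF \<Gamma> sw])
  qed (simp add: deviation_gain_product[OF \<Gamma> sw] set_pmf_iff)
  have "\<not> (\<exists>v. (\<forall>c\<in>?P. v c \<ge> 0) \<and> (\<forall>t\<in>switches \<Gamma>. (\<Sum>c\<in>?P. v c * switch_gain \<Gamma> c t) \<le> 0) \<and>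
      (\<Sum>c\<in>?P. v c * switch_gain \<Gamma> c (i, x, y)) < 0)"
  proof
    assume "\<exists>v. (\<forall>c\<in>?P. v c \<ge> 0) \<and> (\<forall>t\<in>switches \<Gamma>. (\<Sum>c\<in>?P. v c * switch_gain \<Gamma> c t) \<le> 0) \<and>
      (\<Sum>c\<in>?P. v c * switch_gain \<Gamma> c (i, x, y)) < 0"
    then obtain v where v: "\<forall>c\<in>?P. v c \<ge> 0" "\<forall>t\<in>switches \<Gamma>. (\<Sum>c\<in>?P. v c * switch_gain \<Gamma> c t) \<le> 0"
      "(\<Sum>c\<in>?P. v c * switch_gain \<Gamma> c (i, x, y)) < 0" by (elim exE conjE) (rule that)
    have V: "(\<Sum>c\<in>?P. v c) > 0"
    proof (rule ccontr)
      assume "\<not> (\<Sum>c\<in>?P. v c) > 0"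
      moreover have "(\<Sum>c\<in>?P. v c) \<ge> 0" using v(1) by (intro sum_nonneg) simp
      ultimately have "\<forall>c\<in>?P. v c = 0"
        using sum_nonneg_eq_0_iff[OF finite_gameD(5)[OF \<Gamma>], of v] v(1) by simp
      then show False using v(3) by simp
    qed
    obtain \<nu> where \<nu>: "correlated_equilibrium \<Gamma> \<nu>" "\<And>c. c \<in> ?P \<Longrightarrow> pmf \<nu> c = v c / (\<Sum>c\<in>?P. v c)"
      using correlated_equilibrium_of_weights[OF \<Gamma> bspec[OF v(1)] V bspec[OF v(2)]] by blast
    have "deviation_gain \<Gamma> \<nu> i x y = (\<Sum>c\<in>?P. v c * switch_gain \<Gamma> c (i, x, y)) / (\<Sum>c\<in>?P. v c)"
      unfolding deviation_gain_eq[OF \<Gamma> sw] sum_divide_distrib by (intro sum.cong) (simp_all add: \<nu>(2))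
    also have "\<dots> < 0" using v(3) V by (rule divide_neg_pos)
    finally show False using unique[OF \<nu>(1)] tight by simp
  qed
  with switch_complementarity[OF \<Gamma> sw] obtain \<beta> where "dual_vector \<Gamma> \<beta>" "pmf (\<beta> i x) y > 0"
    by (elim disjE) (erule (1) notE, elim exE conjE, rule that)
  then show ?thesis using full sw by (auto simp: full_dual_vector_def switches_iff)
qed

lemma absorbing_closed:
  assumes "absorbing S a B" "x \<in> B" "pmf (a x) y > 0"
  shows "y \<in> B"
proof -
  have "set_pmf (a x) \<subseteq> B" using assms(1,2) by (simp add: absorbing_def)
  then show ?thesis using assms(3) by (simp add: pmf_positive_iff subset_iff)
qed

text \<open>
  From any point of \<open>strategies \<Gamma> i\<close> the chain \<open>\<alpha> i\<close> moves to every point of the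
  support of \<open>\<sigma> i\<close>, so all absorbing sets meet and there is one reduced strategy per player.
  A game with one profile has that profile as an equilibrium, and the equilibrium of \<open>\<Gamma>\<close> that it induces
  can only be the product distribution of \<open>\<sigma>\<close>.
\<close>

lemma full_reduction_profiles:
  assumes \<Gamma>: "finite_game \<Gamma>" and \<sigma>: "\<sigma> \<in> mixed_profiles \<Gamma>"
    and ce: "correlated_equilibrium \<Gamma> (product_distribution \<Gamma> \<sigma>)"
    and unique: "\<And>\<nu>. correlated_equilibrium \<Gamma> \<nu> \<Longrightarrow> \<nu> = product_distribution \<Gamma> \<sigma>"
    and full: "full_dual_vector \<Gamma> \<alpha>"
  shows "profiles (reduced_game \<Gamma> \<alpha>) = {\<sigma>}"
proof -
  let ?H = "reduced_game \<Gamma> \<alpha>"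
  have \<alpha>: "dual_vector \<Gamma> \<alpha>" using full by (simp add: full_dual_vector_def)
  have H: "finite_game ?H" using \<Gamma> \<alpha> by (rule finite_game_reduced)
  have single: "r = r'" if i: "i \<in> players \<Gamma>"
    and r: "r \<in> reduced_strategies (strategies \<Gamma> i) (\<alpha> i)" "r' \<in> reduced_strategies (strategies \<Gamma> i) (\<alpha> i)" for i r r'
  proof -
    let ?S = "strategies \<Gamma> i" and ?supp = "set_pmf (\<sigma> i)"
    have pos: "pmf (\<alpha> i x) y > 0" if "x \<in> ?S" "y \<in> ?S" "x \<in> ?supp \<Longrightarrow> y \<in> ?supp" for x y
      using that i by (intro full_dual_vector_positive[OF \<Gamma> ce unique full]) (simp_all add: switches_iff)
    have supp: "?supp \<subseteq> ?S"
      using PiE_mem[OF \<sigma>[unfolded mixed_profiles_def] i] by (simp add: mixed_strategies_def)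
    have contains: "?supp \<subseteq> B" if B: "absorbing ?S (\<alpha> i) B" for B
    proof
      fix y assume y: "y \<in> ?supp"
      obtain x where x: "x \<in> B" "x \<in> ?S" using B by (auto simp: absorbing_def)
      show "y \<in> B"
        using absorbing_closed[OF B x(1) pos[OF x(2)]] y supp by blast
    qed
    obtain z where z: "z \<in> ?supp" using set_pmf_not_empty[of "\<sigma> i"] by auto
    obtain B B' where B: "minimal_absorbing ?S (\<alpha> i) B" "stationary (\<alpha> i) r" "set_pmf r \<subseteq> B"
      and B': "minimal_absorbing ?S (\<alpha> i) B'" "stationary (\<alpha> i) r'" "set_pmf r' \<subseteq> B'"
      using r by (auto simp: reduced_strategies_def)
    have "B = B'"
      by (rule minimal_absorbing_eq[OF B(1) B'(1), of z])
        (use contains z B(1) B'(1) in \<open>auto simp: minimal_absorbing_def\<close>)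
    then show ?thesis using stationary_unique[OF finite_gameD(3)[OF \<Gamma> i] B] B'(2,3) by blast
  qed
  have "s = \<sigma>" if s: "s \<in> profiles ?H" for s
  proof -
    have "correlated_equilibrium ?H (return_pmf s)"
      unfolding correlated_equilibrium_def
    proof (intro conjI ballI)
      fix i r r' assume "i \<in> players ?H" "r \<in> strategies ?H i" "r' \<in> strategies ?H i"
      then have "r = r'" using single by simp
      then show "deviation_gain ?H (return_pmf s) i r r' \<le> 0" by (simp add: deviation_gain_def)
    qed (use s in simp)
    from unique[OF reduced_equilibrium_induces_equilibrium[OF \<Gamma> \<alpha> this]]
    have "product_distribution \<Gamma> s = product_distribution \<Gamma> \<sigma>" by (simp add: bind_return_pmf)
    then show ?thesis
      using s \<sigma> by (intro product_distribution_inj[OF \<Gamma>]) (simp_all add: profiles_def mixed_profiles_def PiE_def)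
  qed
  then show ?thesis using finite_gameD(7)[OF H] by blast
qed

theorem proposition19:
  fixes \<Gamma> :: "('i, 's) game" and \<mu> :: "('i \<Rightarrow> 's) pmf"
  assumes "finite_game \<Gamma>"
    and "correlated_equilibrium \<Gamma> \<mu>"
    and "\<And>\<nu>. correlated_equilibrium \<Gamma> \<nu> \<Longrightarrow> \<nu> = \<mu>"
  shows "(\<exists>\<sigma>. nash_equilibrium \<Gamma> \<sigma> \<and> \<mu> = product_distribution \<Gamma> \<sigma> \<and>
            (\<forall>G. full_dual_reduction \<Gamma> G \<longrightarrow> profiles G = {\<sigma>}) \<and>
            (\<forall>G. iterative_dual_reduction \<Gamma> G \<and> elementary G \<longrightarrow> profiles G = {\<sigma>})) \<and>
         (\<exists>!G. full_dual_reduction \<Gamma> G)"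
proof -
  note \<Gamma> = assms(1)
  have it_ext: "s \<in> extensional (players \<Gamma>)" if "iterative_dual_reduction \<Gamma> G" "s \<in> profiles G" for G s
    using that(2) iterative_dual_reduction_players[OF that(1)] by (simp add: profiles_def PiE_def)
  have it_profile: "product_distribution \<Gamma> s = \<mu>"
    if "iterative_dual_reduction \<Gamma> G" "elementary G" "s \<in> profiles G" for G s
    using elementary_iterate_profile[OF \<Gamma> assms(3) that] .
  obtain G0 where G0: "iterative_dual_reduction \<Gamma> G0" "elementary G0"
    using elementary_iterate_exists[OF \<Gamma>] .
  have fin0: "finite_game G0" and supp0: "\<forall>i\<in>players \<Gamma>. \<forall>s\<in>strategies G0 i. set_pmf s \<subseteq> strategies \<Gamma> i"
    using iterative_dual_reduction_game[OF G0(1) \<Gamma>] by auto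
  obtain \<sigma> where \<sigma>0: "\<sigma> \<in> profiles G0" using finite_gameD(7)[OF fin0] by blast
  have \<mu>: "\<mu> = product_distribution \<Gamma> \<sigma>" using it_profile[OF G0 \<sigma>0] by simp
  have \<sigma>: "\<sigma> \<in> mixed_profiles \<Gamma>"
    using \<sigma>0 supp0 iterative_dual_reduction_players[OF G0(1)]
    by (auto simp: profiles_def mixed_profiles_def mixed_strategies_def PiE_def Pi_def)
  have ce: "correlated_equilibrium \<Gamma> (product_distribution \<Gamma> \<sigma>)"
    using assms(2) \<mu> by (rule back_subst)
  have unique: "\<nu> = product_distribution \<Gamma> \<sigma>" if "correlated_equilibrium \<Gamma> \<nu>" for \<nu>
    using assms(3)[OF that] \<mu> by (rule trans)
  have nash: "nash_equilibrium \<Gamma> \<sigma>"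
    using nash_of_product_equilibrium[OF \<Gamma> \<sigma> ce] .
  have elementary_case: "profiles G = {\<sigma>}" if G: "iterative_dual_reduction \<Gamma> G" "elementary G" for G
  proof -
    have "s = \<sigma>" if "s \<in> profiles G" for s
      using it_profile[OF G that] \<mu> it_ext[OF G(1) that] it_ext[OF G0(1) \<sigma>0]
      by (intro product_distribution_inj[OF \<Gamma>]) simp_all
    moreover have "finite_game G" using iterative_dual_reduction_game[OF G(1) \<Gamma>] by simp
    ultimately show ?thesis using finite_gameD(7)[of G] by blast
  qed
  have full_case: "profiles (reduced_game \<Gamma> \<alpha>) = {\<sigma>}" if "full_dual_vector \<Gamma> \<alpha>" for \<alpha>
    using full_reduction_profiles[OF \<Gamma> \<sigma> ce unique that] .
  have reduced_eq: "reduced_game \<Gamma> \<alpha> =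
      \<lparr>players = players \<Gamma>, strategies = (\<lambda>i\<in>players \<Gamma>. {\<sigma> i}), utility = mixed_utility \<Gamma>\<rparr>"
    if full: "full_dual_vector \<Gamma> \<alpha>" for \<alpha>
  proof -
    have "reduced_strategies (strategies \<Gamma> i) (\<alpha> i) = {\<sigma> i}" if i: "i \<in> players \<Gamma>" for i
    proof -
      have mem: "\<sigma> \<in> profiles (reduced_game \<Gamma> \<alpha>)" using full_case[OF full] by simp
      from mem have "\<sigma> i \<in> reduced_strategies (strategies \<Gamma> i) (\<alpha> i)"
        using i PiE_mem[of \<sigma> "players \<Gamma>" "strategies (reduced_game \<Gamma> \<alpha>)" i] by (simp add: profiles_def)
      moreover have "r = \<sigma> i" if "r \<in> reduced_strategies (strategies \<Gamma> i) (\<alpha> i)" for r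
      proof -
        have "\<sigma>(i := r) \<in> profiles (reduced_game \<Gamma> \<alpha>)"
          using mem i that by (intro profile_upd) simp_all
        then have "\<sigma>(i := r) = \<sigma>" using full_case[OF full] by simp
        then show ?thesis by (metis fun_upd_same)
      qed
      ultimately show ?thesis by blast
    qed
    then show ?thesis by (simp add: reduced_game_def cong: restrict_cong)
  qed
  obtain \<alpha> where \<alpha>: "full_dual_vector \<Gamma> \<alpha>" using full_dual_vector_exists[OF \<Gamma>] .
  have "\<exists>!G. full_dual_reduction \<Gamma> G"
  proof (rule ex1I)
    show "full_dual_reduction \<Gamma> (reduced_game \<Gamma> \<alpha>)" using \<alpha> by (auto simp: full_dual_reduction_def)
    show "G = reduced_game \<Gamma> \<alpha>" if "full_dual_reduction \<Gamma> G" for G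
      using that reduced_eq \<alpha> by (auto simp: full_dual_reduction_def)
  qed
  moreover have "\<forall>G. full_dual_reduction \<Gamma> G \<longrightarrow> profiles G = {\<sigma>}"
    using full_case by (auto simp: full_dual_reduction_def)
  ultimately show ?thesis
    using nash \<mu> elementary_case by blast
qed

end
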